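(* Let $\mathsf R,\mathsf E$ be totally ordered finite sets with $|\mathsf R|=d\le n=|\mathsf E|$, let $\mathcal T$ be a triangulation of $\triangle_{d-1}\times\triangle_{n-1}$ with polyhedral matching field $(M_\sigma)$, let $A\in\{-1,1\}^{\mathsf R\times\mathsf E}$, and let $\mathcal M$ be the oriented matroid with chirotope $\chi:\sigma\mapsto\operatorname{sign}(M_\sigma)\prod_{e\in M_\sigma}A_e$. For a covector pd-graph $F$ of $\mathcal T$, $\psi_A(S,F)$ is a covector of $\mathcal M$ for every sign vector $S\in\{-1,0,1\}^{\mathsf R}$ whose support contains the set of non-isolated nodes of $F$ in $\mathsf R$.
   Context: **Triangulations and matching fields.** A triangulation of $\triangle_{d-1}\times\triangle_{n-1}$ (with $\triangle_{k-1}=\operatorname{conv}\{\mathbf e_1,\dots,\mathbf e_k\}$) is a collection of full-dimensional simplices with vertices among the $(\mathbf e_i,\mathbf e_j)$, with union $\triangle_{d-1}\times\triangle_{n-1}$, any two intersecting in a common face. Identifying $(\mathbf e_i,\mathbf e_j)$ with the edge $(i,j)$ of $K_{\mathsf R,\mathsf E}$, each simplex becomes a spanning tree of $K_{\mathsf R,\mathsf E}$. For every $d$-subset $\sigma\subseteq\mathsf E$ there is exactly one perfect matching $M_\sigma$ between $\mathsf R$ and $\sigma$ contained in at least one of these trees; $(M_\sigma)$ is the polyhedral matching field. $\operatorname{sign}(M_\sigma)$ is the sign of the permutation $[d]\to\mathsf R\to\sigma\to[d]$ (order-preserving bijections at both ends, $M_\sigma$ in the middle). $\chi$ (extended to an alternating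 map) is known to be a chirotope. **Covector pd-graph.** A covector pd-graph is a subgraph of a tree of $\mathcal T$ with no isolated node in $\mathsf E$. **The map $\psi$.** For $S\in\{-1,0,1\}^{\mathsf R}$ and $F\subseteq\mathsf R\times\mathsf E$, let $SA_F$ be the matrix with $(SA_F)_{i,j}=S_iA_{i,j}$ if $(i,j)\in F$ and $0$ otherwise. Then $\psi_A(S,F)=Z\in\{-1,0,1\}^{\mathsf E}$, where $Z_j=0$ if column $j$ of $SA_F$ has both positive and negative entries or is all zero, $Z_j=1$ if column $j$ is non-zero with only non-negative entries, and $Z_j=-1$ if column $j$ is non-zero with only non-positive entries. Covectors are in the standard sense of oriented matroid theory (compositions of signed cocircuits, and the zero vector). *)

theory Defs
  imports "HOL-Analysis.Analysis"
begin

text \<open>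
  The totally ordered finite sets \<open>R\<close> and \<open>E\<close> are the universes of two types of sort
  \<open>{finite, linorder}\<close>, so \<open>d = CARD('r)\<close> and \<open>n = CARD('e)\<close>. Sign vectors are
  functions into \<open>{-1, 0, 1} :: int set\<close>.
\<close>

section \<open>Triangulations of a product of two simplices\<close>

definition std_simplex :: "(real ^ 'k::finite) set"
  where "std_simplex = convex hull (range (\<lambda>i. axis i 1))"

definition edge_point :: "'r::finite \<times> 'e::finite \<Rightarrow> (real ^ 'r) \<times> (real ^ 'e)"
  where "edge_point = (\<lambda>(i, j). (axis i 1, axis j 1))"

text \<open>
  The library predicate \<^const>\<open>triangulation\<close> says that the members are finitely many simplices,
  any two of which meet in a common face. The product of simplices has dimension \<open>d + n - 2\<close>.
\<close>

definition product_triangulation ::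
  "((real ^ 'r::finite) \<times> (real ^ 'e::finite)) set set \<Rightarrow> bool"
  where "product_triangulation \<T> \<longleftrightarrow>
    triangulation \<T> \<and>
    (\<forall>D\<in>\<T>. (int CARD('r) + int CARD('e) - 2) simplex D \<and>
            {x. x extreme_point_of D} \<subseteq> range edge_point) \<and>
    \<Union>\<T> = std_simplex \<times> std_simplex"

definition simplex_graph ::
  "((real ^ 'r::finite) \<times> (real ^ 'e::finite)) set \<Rightarrow> ('r \<times> 'e) set"
  where "simplex_graph D = {p. edge_point p extreme_point_of D}"

text \<open>A subgraph keeps all the nodes, so it is given by its set of edges.\<close>

definition covector_pd_graph ::
  "((real ^ 'r::finite) \<times> (real ^ 'e::finite)) set set \<Rightarrow> ('r \<times> 'e) set \<Rightarrow> bool"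
  where "covector_pd_graph \<T> F \<longleftrightarrow>
    (\<exists>D\<in>\<T>. F \<subseteq> simplex_graph D) \<and> (\<forall>j. \<exists>i. (i, j) \<in> F)"


section \<open>The polyhedral matching field and its chirotope\<close>

definition perfect_matching :: "('r \<times> 'e) set \<Rightarrow> 'e set \<Rightarrow> bool"
  where "perfect_matching M \<sigma> \<longleftrightarrow>
    M \<subseteq> UNIV \<times> \<sigma> \<and> (\<forall>i. \<exists>!j. (i, j) \<in> M) \<and> (\<forall>j\<in>\<sigma>. \<exists>!i. (i, j) \<in> M)"

text \<open>Only meaningful for \<open>card \<sigma> = d\<close>.\<close>

definition matching_field ::
  "((real ^ 'r::finite) \<times> (real ^ 'e::finite)) set set \<Rightarrow> 'e set \<Rightarrow> ('r \<times> 'e) set"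
  where "matching_field \<T> \<sigma> =
    (THE M. perfect_matching M \<sigma> \<and> (\<exists>D\<in>\<T>. M \<subseteq> simplex_graph D))"

text \<open>
  For a list \<open>xs\<close> of \<open>m\<close> distinct elements, this is the permutation of \<open>{0..<m}\<close> obtained by
  composing \<open>k \<mapsto> xs ! k\<close> with the order-preserving bijection from \<open>set xs\<close> to \<open>{0..<m}\<close>.
\<close>

definition order_perm :: "'a::linorder list \<Rightarrow> nat \<Rightarrow> nat"
  where "order_perm xs k =
    (if k < length xs then card {y \<in> set xs. y < xs ! k} else k)"

text \<open>
  The list below runs through the partners of the elements of \<open>R\<close> in increasing order, so its
  \<^const>\<open>order_perm\<close> is the composite of \<open>[d] \<rightarrow> R \<rightarrow> \<sigma> \<rightarrow> [d]\<close>.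
\<close>

definition matching_sign :: "('r::{finite,linorder} \<times> 'e::linorder) set \<Rightarrow> int"
  where "matching_sign M =
    sign (order_perm (map (\<lambda>i. THE j. (i, j) \<in> M) (sorted_list_of_set UNIV)))"

definition matching_chirotope ::
  "((real ^ 'r::{finite,linorder}) \<times> (real ^ 'e::{finite,linorder})) set set \<Rightarrow>
   ('r \<Rightarrow> 'e \<Rightarrow> int) \<Rightarrow> 'e set \<Rightarrow> int"
  where "matching_chirotope \<T> A \<sigma> =
    matching_sign (matching_field \<T> \<sigma>) * (\<Prod>(i, j)\<in>matching_field \<T> \<sigma>. A i j)"

text \<open>Extension of a map on \<open>d\<close>-subsets to an alternating map on \<open>d\<close>-tuples.\<close>

definition alternating_extension :: "('e::linorder set \<Rightarrow> int) \<Rightarrow> 'e list \<Rightarrow> int"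
  where "alternating_extension chi xs =
    (if distinct xs then sign (order_perm xs) * chi (set xs) else 0)"


section \<open>Covectors of the oriented matroid with a given chirotope\<close>

text \<open>
  The signed cocircuits of the oriented matroid of rank \<open>d\<close> with alternating chirotope \<open>chi\<close> are
  the non-zero sign vectors \<open>\<plusminus>(e \<mapsto> chi(e, x\<^sub>2, \<dots>, x\<^sub>d))\<close>.
\<close>

definition signed_cocircuits :: "nat \<Rightarrow> ('e list \<Rightarrow> int) \<Rightarrow> ('e \<Rightarrow> int) set"
  where "signed_cocircuits d chi =
    {Z. (\<exists>xs. length xs = d - 1 \<and>
           (Z = (\<lambda>e. chi (e # xs)) \<or> Z = (\<lambda>e. - chi (e # xs)))) \<and>
        Z \<noteq> (\<lambda>e. 0)}"

definition sign_comp :: "('e \<Rightarrow> int) \<Rightarrow> ('e \<Rightarrow> int) \<Rightarrow> 'e \<Rightarrow> int"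
  where "sign_comp X Y = (\<lambda>e. if X e \<noteq> 0 then X e else Y e)"

inductive_set covectors :: "nat \<Rightarrow> ('e list \<Rightarrow> int) \<Rightarrow> ('e \<Rightarrow> int) set"
  for d :: nat and chi :: "'e list \<Rightarrow> int"
  where
    zero: "(\<lambda>e. 0) \<in> covectors d chi"
  | comp: "X \<in> signed_cocircuits d chi \<Longrightarrow> Y \<in> covectors d chi \<Longrightarrow>
      sign_comp X Y \<in> covectors d chi"


section \<open>The map \<open>\<psi>\<close>\<close>

definition signed_restriction ::
  "('r \<Rightarrow> 'e \<Rightarrow> int) \<Rightarrow> ('r \<Rightarrow> int) \<Rightarrow> ('r \<times> 'e) set \<Rightarrow> 'r \<Rightarrow> 'e \<Rightarrow> int"
  where "signed_restriction A S F i j = (if (i, j) \<in> F then S i * A i j else 0)"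

definition psi ::
  "('r \<Rightarrow> 'e \<Rightarrow> int) \<Rightarrow> ('r \<Rightarrow> int) \<Rightarrow> ('r \<times> 'e) set \<Rightarrow> 'e \<Rightarrow> int"
  where "psi A S F j =
    (let c = (\<lambda>i. signed_restriction A S F i j) in
     if ((\<exists>i. c i > 0) \<and> (\<exists>i. c i < 0)) \<or> (\<forall>i. c i = 0) then 0
     else if \<forall>i. c i \<ge> 0 then 1
     else -1)"

end

theory Submission
  imports Defs "Jordan_Normal_Form.Determinant"
begin

text \<open>
  A point of the product of simplices is a non-negative flow on the complete bipartite graph, with
  prescribed row and column sums. Since the triangulation covers the product, every pair of margins
  is attained by a flow supported on a tree of the triangulation; since two simplices meet in a
  common face, that flow is unique, even across trees. Well-chosen margins force the degrees of the
  support: equal row sums and equal column sums on a \<open>(d + 1)\<close>-subset give a tree in which every row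
  has degree 2, and large column sums on a \<open>(d - 1)\<close>-subset \<open>\<tau>\<close> give a tree in which the columns
  have degree 2 on \<open>\<tau>\<close> and 1 elsewhere. The first kind of tree carries a signed circuit \<open>X\<close>, and the
  second one carries a sign vector of the form \<open>psi A S G\<close> that is a signed cocircuit up to sign.

  If \<open>X\<close> were not orthogonal to \<open>psi A S F\<close>, then a closed walk alternating between edges of \<open>F\<close> and
  edges of the circuit tree would give two different flows with the same margins. Finally, a
  deletion-contraction induction in the manner of Farkas' lemma shows that a sign vector orthogonal
  to all circuits is conformally covered by cocircuits, and hence is their composition.
\<close>

no_notation Matrix.vec_index (infixl \<open>$\<close> 100)

section \<open>Flows on the trees of a triangulation\<close>

text \<open>Turns geometry into combinatorics: coefficients on the vertices form a flow, and the
  point they describe is its pair of margins. Affine relations between vertices become flows with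
  zero margins.\<close>

lemma sum_edge_point:
  fixes f :: "'r::finite \<times> 'e::finite \<Rightarrow> real"
  shows "(\<Sum>p\<in>UNIV. f p *\<^sub>R edge_point p)
    = ((\<chi> i. \<Sum>j\<in>UNIV. f (i, j)), (\<chi> j. \<Sum>i\<in>UNIV. f (i, j)))"
proof -
  have row: "(\<Sum>p\<in>UNIV. f p * axis (fst p) 1 $ i) = (\<Sum>j\<in>UNIV. f (i, j))" for i
  proof -
    have "(\<Sum>p\<in>UNIV. f p * axis (fst p) 1 $ i) = sum f (Pair i ` UNIV)"
      by (rule sum.mono_neutral_cong_right) (auto simp: axis_def)
    then show ?thesis by (simp add: sum.reindex inj_on_def)
  qed
  have col: "(\<Sum>p\<in>UNIV. f p * axis (snd p) 1 $ j) = (\<Sum>i\<in>UNIV. f (i, j))" for j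
  proof -
    have "(\<Sum>p\<in>UNIV. f p * axis (snd p) 1 $ j) = sum f ((\<lambda>i. (i, j)) ` UNIV)"
      by (rule sum.mono_neutral_cong_right) (auto simp: axis_def)
    then show ?thesis by (simp add: sum.reindex inj_on_def)
  qed
  have fst: "fst (edge_point p) = axis (fst p) 1" and snd: "snd (edge_point p) = axis (snd p) 1"
    for p :: "'r \<times> 'e" by (simp_all add: edge_point_def case_prod_unfold)
  show ?thesis
  proof (rule prod_eqI)
    show "fst (\<Sum>p\<in>UNIV. f p *\<^sub>R edge_point p)
        = fst ((\<chi> i. \<Sum>j\<in>UNIV. f (i, j)), (\<chi> j. \<Sum>i\<in>UNIV. f (i, j)))"
      by (simp only: fst_sum fst_scaleR fst Finite_Cartesian_Product.vec_eq_iff sum_component vector_scaleR_component real_scaleR_def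
          row fst_conv vec_lambda_beta) simp
    show "snd (\<Sum>p\<in>UNIV. f p *\<^sub>R edge_point p)
        = snd ((\<chi> i. \<Sum>j\<in>UNIV. f (i, j)), (\<chi> j. \<Sum>i\<in>UNIV. f (i, j)))"
      by (simp only: snd_sum snd_scaleR snd Finite_Cartesian_Product.vec_eq_iff sum_component vector_scaleR_component real_scaleR_def
          col snd_conv vec_lambda_beta) simp
  qed
qed

section \<open>Graphs of simplices are forests\<close>

lemma inj_edge_point: "inj (edge_point :: 'r::finite \<times> 'e::finite \<Rightarrow> _)"
proof (rule injI)
  fix p q :: "'r \<times> 'e" assume "edge_point p = edge_point q"
  then have "axis (fst p) 1 = (axis (fst q) 1 :: real ^ 'r)" "axis (snd p) 1 = (axis (snd q) 1 :: real ^ 'e)"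
    by (simp_all add: edge_point_def case_prod_unfold)
  then show "p = q" by (simp add: axis_eq_axis prod_eq_iff)
qed

lemma product_triangulation_simplex:
  fixes \<T> :: "((real ^ 'r::finite) \<times> (real ^ 'e::finite)) set set"
  assumes "product_triangulation \<T>" "D \<in> \<T>"
  shows "\<not> affine_dependent (edge_point ` simplex_graph D)"
    and "D = convex hull (edge_point ` simplex_graph D)"
proof -
  have D: "(int CARD('r) + int CARD('e) - 2) simplex D" "{x. x extreme_point_of D} \<subseteq> range edge_point"
    using assms unfolding product_triangulation_def by auto
  from D(1) obtain C where C: "\<not> affine_dependent C" "D = convex hull C"
    unfolding simplex_def by (elim exE conjE) (rule that)
  have "{x. x extreme_point_of D} = C"
    using C by (simp add: extreme_point_of_convex_hull_affine_independent)
  with D(2) have "edge_point ` simplex_graph D = C"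
    unfolding simplex_graph_def by auto
  with C show "\<not> affine_dependent (edge_point ` simplex_graph D)"
    and "D = convex hull (edge_point ` simplex_graph D)" by auto
qed

text \<open>Vanishing row sums make the total coefficient vanish as well, so a non-zero
  \<open>g\<close> would be an affine dependence between the vertices of \<open>D\<close>.\<close>

lemma zero_margins_imp_zero:
  fixes g :: "'r::finite \<times> 'e::finite \<Rightarrow> real"
  assumes "product_triangulation \<T>" "D \<in> \<T>"
    and supp: "\<And>p. g p \<noteq> 0 \<Longrightarrow> p \<in> simplex_graph D"
    and 0: "(\<Sum>p\<in>UNIV. g p *\<^sub>R edge_point p) = 0"
  shows "g p = 0"
proof (rule ccontr)
  assume p: "g p \<noteq> 0"
  let ?G = "simplex_graph D"
  let ?U = "\<lambda>v. g (inv_into UNIV edge_point v)"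
  have row: "(\<Sum>j\<in>UNIV. g (i, j)) = 0" for i
    using 0 by (simp add: sum_edge_point Finite_Cartesian_Product.vec_eq_iff zero_prod_def)
  have "sum g UNIV = (\<Sum>i\<in>UNIV. \<Sum>j\<in>UNIV. g (i, j))"
    by (simp add: sum.cartesian_product UNIV_Times_UNIV [symmetric] del: UNIV_Times_UNIV)
  then have "sum g UNIV = 0" by (simp add: row)
  moreover have "sum g ?G = sum g UNIV"
    by (rule sum.mono_neutral_left) (use supp in auto)
  moreover have "(\<Sum>p\<in>?G. g p *\<^sub>R edge_point p) = (\<Sum>p\<in>UNIV. g p *\<^sub>R edge_point p)"
    by (rule sum.mono_neutral_left) (use supp in auto)
  ultimately have "sum ?U (edge_point ` ?G) = 0"
    and "(\<Sum>v\<in>edge_point ` ?G. ?U v *\<^sub>R v) = 0"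
    using 0 by (simp_all add: sum.reindex inj_on_subset [OF inj_edge_point] inv_f_f [OF inj_edge_point])
  moreover have "\<exists>v\<in>edge_point ` ?G. ?U v \<noteq> 0"
    using p supp [OF p] by (auto simp: inv_f_f [OF inj_edge_point])
  ultimately have "affine_dependent (edge_point ` ?G)"
    by (subst affine_dependent_explicit_finite) auto
  then show False using product_triangulation_simplex(1) [OF assms(1,2)] by simp
qed

text \<open>Acyclicity of the trees in counting form: the edge points of \<open>H\<close> are
  linearly independent and lie in the span of fewer vectors than \<open>H\<close> touches
  nodes.\<close>

lemma card_edges_less:
  fixes H :: "('r::finite \<times> 'e::finite) set"
  assumes "product_triangulation \<T>" "D \<in> \<T>" "H \<subseteq> simplex_graph D" "H \<noteq> {}"
  shows "card H < card (fst ` H) + card (snd ` H)"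
proof -
  obtain i0 j0 where ij0: "(i0, j0) \<in> H" using assms(4) by auto
  \<comment> \<open>The point of \<open>(i, j)\<close> is that of \<open>(i, j0)\<close> plus a
    difference of two column units. Omitting the zero difference at \<open>j0\<close> gains the one
    that makes the bound strict.\<close>
  define B :: "((real ^ 'r) \<times> (real ^ 'e)) set"
    where "B = (\<lambda>i. (axis i 1, axis j0 1)) ` fst ` H \<union> (\<lambda>j. (0, axis j 1 - axis j0 1)) ` (snd ` H - {j0})"
  have "independent (edge_point ` H)"
  proof (rule ccontr)
    assume "\<not> independent (edge_point ` H)"
    then obtain u v where u: "(\<Sum>w\<in>edge_point ` H. u w *\<^sub>R w) = 0" "v \<in> edge_point ` H" "u v \<noteq> 0"
      unfolding dependent_finite [OF finite_imageI [OF finite]] by blast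
    define g where "g p = (if p \<in> H then u (edge_point p) else 0)" for p
    have "(\<Sum>p\<in>UNIV. g p *\<^sub>R edge_point p) = (\<Sum>p\<in>H. u (edge_point p) *\<^sub>R edge_point p)"
      by (rule sum.mono_neutral_cong_right) (auto simp: g_def)
    also have "\<dots> = 0" using u(1)
      by (simp add: sum.reindex inj_on_subset [OF inj_edge_point])
    finally have "g p = 0" for p
      by (intro zero_margins_imp_zero [OF assms(1,2)]) (use assms(3) in \<open>auto simp: g_def split: if_splits\<close>)
    then show False using u(2,3) unfolding g_def by (metis imageE)
  qed
  moreover have "edge_point ` H \<subseteq> span B"
  proof (rule image_subsetI)
    fix p assume "p \<in> H"
    moreover obtain i j where p: "p = (i, j)" by fastforce
    ultimately have ij: "i \<in> fst ` H" "j \<in> snd ` H" by force+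
    have 1: "(axis i 1, axis j0 1) \<in> span B"
      unfolding B_def by (intro span_base UnI1 imageI ij)
    have 2: "(0, axis j 1 - axis j0 1) \<in> span B"
    proof (cases "j = j0")
      case True
      then show ?thesis using span_zero [of B] by (simp add: zero_prod_def)
    next
      case False
      then show ?thesis unfolding B_def by (intro span_base UnI2 imageI) (simp add: ij)
    qed
    show "edge_point p \<in> span B"
      using span_add [OF 1 2] by (simp add: edge_point_def p)
  qed
  moreover have "finite B" by (simp add: B_def)
  ultimately have "card (edge_point ` H) \<le> card B"
    using independent_span_bound by blast
  also have "card B \<le> card (fst ` H) + card (snd ` H - {j0})"
    unfolding B_def by (rule order_trans [OF card_Un_le]) (intro add_mono card_image_le; simp)
  also have "\<dots> < card (fst ` H) + card (snd ` H)"
    using ij0 by (intro add_strict_left_mono psubset_card_mono) force+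
  finally show ?thesis
    by (simp add: card_image inj_on_subset [OF inj_edge_point])
qed

section \<open>Existence and uniqueness of flows with given margins\<close>

lemma mem_std_simplex:
  fixes x :: "real ^ 'k::finite"
  assumes "\<And>i. 0 \<le> x $ i" "(\<Sum>i\<in>UNIV. x $ i) = 1"
  shows "x \<in> std_simplex"
proof -
  have "(\<Sum>i\<in>UNIV. (x $ i) *\<^sub>R (axis i 1 :: real ^ 'k)) \<in> std_simplex"
    unfolding std_simplex_def
    by (intro convex_sum hull_inc rangeI) (simp_all add: assms)
  moreover have "(\<Sum>i\<in>UNIV. (x $ i) *\<^sub>R (axis i 1 :: real ^ 'k)) = x"
    using basis_expansion [of x] by (simp add: scalar_mult_eq_scaleR)
  ultimately show ?thesis by simp
qed

text \<open>Dividing by the common total \<open>s\<close> gives a point of the product, hence of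
  some simplex; its barycentric coordinates there, multiplied by \<open>s\<close>, are the
  flow.\<close>

lemma flow_exists:
  fixes \<T> :: "((real ^ 'r::finite) \<times> (real ^ 'e::finite)) set set"
    and x :: "'r \<Rightarrow> real" and y :: "'e \<Rightarrow> real"
  assumes T: "product_triangulation \<T>"
    and x: "\<And>i. 0 \<le> x i" and y: "\<And>j. 0 \<le> y j"
    and s: "sum x UNIV = s" "sum y UNIV = s" "s > 0"
  shows "\<exists>D\<in>\<T>. \<exists>f. (\<forall>p. 0 \<le> f p) \<and> (\<forall>p. f p \<noteq> 0 \<longrightarrow> p \<in> simplex_graph D) \<and>
    (\<forall>i. (\<Sum>j\<in>UNIV. f (i, j)) = x i) \<and> (\<forall>j. (\<Sum>i\<in>UNIV. f (i, j)) = y j)"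
proof -
  define z :: "(real ^ 'r) \<times> (real ^ 'e)" where "z = ((\<chi> i. x i / s), (\<chi> j. y j / s))"
  have "z \<in> std_simplex \<times> std_simplex"
    unfolding z_def using x y s by (auto intro!: mem_std_simplex simp flip: sum_divide_distrib)
  then obtain D where D: "D \<in> \<T>" "z \<in> D"
    using T unfolding product_triangulation_def by blast
  have "z \<in> convex hull (edge_point ` simplex_graph D)"
    by (rule subsetD [OF equalityD1 [OF product_triangulation_simplex(2) [OF T D(1)]] D(2)])
  then have "\<exists>u. (\<forall>v\<in>edge_point ` simplex_graph D. 0 \<le> u v) \<and> sum u (edge_point ` simplex_graph D) = 1 \<and>
      (\<Sum>v\<in>edge_point ` simplex_graph D. u v *\<^sub>R v) = z"
    by (simp only: convex_hull_finite [OF finite_imageI [OF finite]] mem_Collect_eq)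
  then obtain u where u: "\<forall>v\<in>edge_point ` simplex_graph D. 0 \<le> u v"
    "(\<Sum>v\<in>edge_point ` simplex_graph D. u v *\<^sub>R v) = z"
    by (elim exE conjE) (rule that)
  define f where "f p = (if p \<in> simplex_graph D then s * u (edge_point p) else 0)" for p
  have "(\<Sum>p\<in>UNIV. f p *\<^sub>R edge_point p)
      = (\<Sum>p\<in>simplex_graph D. s *\<^sub>R (u (edge_point p) *\<^sub>R edge_point p))"
    by (rule sum.mono_neutral_cong_right) (auto simp: f_def)
  also have "\<dots> = s *\<^sub>R z"
    using u(2) by (simp add: sum.reindex inj_on_subset [OF inj_edge_point] flip: scaleR_sum_right del: scaleR_scaleR)
  finally have eq: "((\<chi> i. \<Sum>j\<in>UNIV. f (i, j)), (\<chi> j. \<Sum>i\<in>UNIV. f (i, j))) = s *\<^sub>R z"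
    unfolding sum_edge_point .
  have row: "(\<Sum>j\<in>UNIV. f (i, j)) = x i" for i
    using arg_cong [OF eq, of "\<lambda>z. fst z $ i"] s(3) by (simp add: z_def)
  have col: "(\<Sum>i\<in>UNIV. f (i, j)) = y j" for j
    using arg_cong [OF eq, of "\<lambda>z. snd z $ j"] s(3) by (simp add: z_def)
  have "0 \<le> f p" for p using u(1) s(3) by (simp add: f_def)
  moreover have "f p \<noteq> 0 \<longrightarrow> p \<in> simplex_graph D" for p by (simp add: f_def)
  ultimately show ?thesis using row col by (intro bexI [OF _ D(1)] exI [of _ f] conjI allI)
qed

text \<open>If \<open>w\<close> has weight strictly between 0 and 1, the combination lies in the
  open segment from \<open>w\<close> to the normalised average \<open>b\<close> of the other
  vertices, and a face contains both ends of any such segment that it meets.\<close>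

lemma face_of_convex_combination:
  assumes W: "W face_of convex hull V" and V: "finite V"
    and c: "\<And>v. v \<in> V \<Longrightarrow> 0 \<le> c v" "sum c V = 1" "(\<Sum>v\<in>V. c v *\<^sub>R v) \<in> W"
    and w: "w \<in> V" "c w \<noteq> 0"
  shows "w \<in> W"
proof -
  define z where "z = (\<Sum>v\<in>V. c v *\<^sub>R v)"
  have sum_w: "sum c V = c w + sum c (V - {w})" by (rule sum.remove [OF V w(1)])
  have z: "z = c w *\<^sub>R w + (\<Sum>v\<in>V - {w}. c v *\<^sub>R v)"
    unfolding z_def by (rule sum.remove [OF V w(1)])
  have cw: "0 < c w" using c(1) w by (simp add: order_less_le)
  have rest: "0 \<le> sum c (V - {w})" by (rule sum_nonneg) (use c(1) in auto)
  show ?thesis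
  proof (cases "c w = 1")
    case True
    then have "sum c (V - {w}) = 0" using c(2) sum_w by simp
    then have "\<forall>v\<in>V - {w}. c v = 0" using V c(1) by (subst (asm) sum_nonneg_eq_0_iff) auto
    then have "z = w" using z True by simp
    then show ?thesis using c(3) z_def by simp
  next
    case False
    then have lt: "c w < 1" using rest c(2) sum_w by simp
    define b where "b = (\<Sum>v\<in>V - {w}. (c v / (1 - c w)) *\<^sub>R v)"
    have b: "b \<in> convex hull V" unfolding b_def
    proof (rule convex_sum)
      show "(\<Sum>v\<in>V - {w}. c v / (1 - c w)) = 1"
        using lt c(2) sum_w by (simp flip: sum_divide_distrib)
    qed (use V c(1) lt in \<open>auto intro: hull_inc\<close>)
    have "(1 - c w) *\<^sub>R b = (\<Sum>v\<in>V - {w}. c v *\<^sub>R v)"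
      using lt by (simp add: b_def scaleR_sum_right)
    then have zb: "z = c w *\<^sub>R w + (1 - c w) *\<^sub>R b" using z by simp
    show ?thesis
    \<comment> \<open>For \<open>w = b\<close> the open segment is empty, but then the combination
      is \<open>w\<close> itself.\<close>
    proof (cases "w = b")
      case True
      then have "z = w" using zb by (simp flip: scaleR_add_left)
      then show ?thesis using c(3) z_def by simp
    next
      case False
      have "z \<in> open_segment b w"
        unfolding in_segment using False cw lt zb by (auto simp: add.commute)
      then show ?thesis
        using W b c(3) hull_inc [OF w(1), of convex] unfolding face_of_def z_def by metis
    qed
  qed
qed

text \<open>After scaling, both flows describe the same point of \<open>D \<inter> D'\<close>. As
  this is a face of both simplices, \<open>f\<close> is supported on \<open>D'\<close> too, and the
  difference of the flows has zero margins on one simplex.\<close>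

lemma flow_unique:
  fixes f f' :: "'r::finite \<times> 'e::finite \<Rightarrow> real"
  assumes T: "product_triangulation \<T>" and D: "D \<in> \<T>" "D' \<in> \<T>"
    and f: "\<And>p. 0 \<le> f p" "\<And>p. f p \<noteq> 0 \<Longrightarrow> p \<in> simplex_graph D"
    and f': "\<And>p. 0 \<le> f' p" "\<And>p. f' p \<noteq> 0 \<Longrightarrow> p \<in> simplex_graph D'"
    and row: "\<And>i. (\<Sum>j\<in>UNIV. f (i, j)) = (\<Sum>j\<in>UNIV. f' (i, j))"
    and col: "\<And>j. (\<Sum>i\<in>UNIV. f (i, j)) = (\<Sum>i\<in>UNIV. f' (i, j))"
  shows "f p = f' p"
proof -
  have eq: "(\<Sum>p\<in>UNIV. f p *\<^sub>R edge_point p) = (\<Sum>p\<in>UNIV. f' p *\<^sub>R edge_point p)"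
    by (simp add: sum_edge_point row col)
  have total: "sum h UNIV = (\<Sum>i\<in>UNIV. \<Sum>j\<in>UNIV. h (i, j))" for h :: "'r \<times> 'e \<Rightarrow> real"
    by (simp add: sum.cartesian_product UNIV_Times_UNIV [symmetric] del: UNIV_Times_UNIV)
  have tot: "sum f UNIV = sum f' UNIV" by (simp add: total row)
  show ?thesis
  proof (cases "sum f UNIV = 0")
    \<comment> \<open>A zero total forces both non-negative flows to vanish; the other case divides
      by the total.\<close>
    case True
    then show ?thesis using tot f(1) f'(1) sum_nonneg_eq_0_iff [of UNIV f] sum_nonneg_eq_0_iff [of UNIV f']
      by (cases p) simp
  next
    case False
    define s where "s = sum f UNIV"
    have s: "s > 0" using False f(1) by (simp add: s_def sum_nonneg order_less_le)
    have comb: "(\<Sum>v\<in>edge_point ` simplex_graph E. h (inv_into UNIV edge_point v) / s) = 1"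
      "(\<Sum>v\<in>edge_point ` simplex_graph E. (h (inv_into UNIV edge_point v) / s) *\<^sub>R v)
        = (1 / s) *\<^sub>R (\<Sum>p\<in>UNIV. h p *\<^sub>R edge_point p)"
      if "\<And>p. h p \<noteq> 0 \<Longrightarrow> p \<in> simplex_graph E" "sum h UNIV = s" for h E
    proof -
      have "sum h (simplex_graph E) = sum h UNIV"
        by (rule sum.mono_neutral_left) (use that in auto)
      then show "(\<Sum>v\<in>edge_point ` simplex_graph E. h (inv_into UNIV edge_point v) / s) = 1"
        using that s by (simp add: sum.reindex inj_on_subset [OF inj_edge_point]
            inv_f_f [OF inj_edge_point] flip: sum_divide_distrib)
      have "(\<Sum>p\<in>simplex_graph E. h p *\<^sub>R edge_point p) = (\<Sum>p\<in>UNIV. h p *\<^sub>R edge_point p)"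
        by (rule sum.mono_neutral_left) (use that in auto)
      from arg_cong [OF this, of "scaleR (1 / s)"]
      show "(\<Sum>v\<in>edge_point ` simplex_graph E. (h (inv_into UNIV edge_point v) / s) *\<^sub>R v)
        = (1 / s) *\<^sub>R (\<Sum>p\<in>UNIV. h p *\<^sub>R edge_point p)"
        by (simp add: sum.reindex inj_on_subset [OF inj_edge_point]
            inv_f_f [OF inj_edge_point] scaleR_sum_right)
    qed
    define z where "z = (1 / s) *\<^sub>R (\<Sum>p\<in>UNIV. f p *\<^sub>R edge_point p)"
    have zD: "z \<in> E" if "\<And>p. 0 \<le> h p" "\<And>p. h p \<noteq> 0 \<Longrightarrow> p \<in> simplex_graph E" "sum h UNIV = s"
      "(\<Sum>p\<in>UNIV. h p *\<^sub>R edge_point p) = (\<Sum>p\<in>UNIV. f p *\<^sub>R edge_point p)" "E \<in> \<T>" for h E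
    proof -
      have "(\<Sum>v\<in>edge_point ` simplex_graph E. (h (inv_into UNIV edge_point v) / s) *\<^sub>R v)
          \<in> convex hull (edge_point ` simplex_graph E)"
        by (rule convex_sum) (use that s comb(1) [OF that(2,3)] in \<open>auto intro: hull_inc\<close>)
      then have "z \<in> convex hull (edge_point ` simplex_graph E)"
        using comb(2) [OF that(2,3)] that(4) by (simp add: z_def)
      then show ?thesis
        by (rule subsetD [OF equalityD2 [OF product_triangulation_simplex(2) [OF T that(5)]]])
    qed
    have face: "(D \<inter> D') face_of D" "(D \<inter> D') face_of D'"
      using T D Int_commute [of D D'] unfolding product_triangulation_def triangulation_def by metis+
    \<comment> \<open>Moves the support of \<open>f\<close> from \<open>D\<close> to
      \<open>D'\<close>: its vertices lie in the common face, and the extreme points of a face are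
      the extreme points of the simplex that lie in it.\<close>
    have "q \<in> simplex_graph D'" if "f q \<noteq> 0" for q
    proof -
      have "edge_point q \<in> D \<inter> D'"
      proof (rule face_of_convex_combination)
        show "(D \<inter> D') face_of convex hull (edge_point ` simplex_graph D)"
          by (rule subst [OF product_triangulation_simplex(2) [OF T D(1)], of "\<lambda>E. (D \<inter> D') face_of E"])
            (rule face(1))
        show "(\<Sum>v\<in>edge_point ` simplex_graph D. f (inv_into UNIV edge_point v) / s) = 1"
          by (rule comb(1)) (use f(2) s_def in auto)
        show "(\<Sum>v\<in>edge_point ` simplex_graph D. (f (inv_into UNIV edge_point v) / s) *\<^sub>R v) \<in> D \<inter> D'"
        proof (subst comb(2))
          have "z \<in> D" by (rule zD [of f]) (use f D s_def in auto)
          moreover have "z \<in> D'" by (rule zD [of f']) (use f' D s_def tot eq in auto)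
          ultimately show "(1 / s) *\<^sub>R (\<Sum>p\<in>UNIV. f p *\<^sub>R edge_point p) \<in> D \<inter> D'"
            by (simp add: z_def)
        qed (use f(2) s_def in auto)
        show "edge_point q \<in> edge_point ` simplex_graph D" using f(2) that by blast
        show "f (inv_into UNIV edge_point (edge_point q)) / s \<noteq> 0"
          using that s by (simp add: inv_f_f [OF inj_edge_point])
      qed (use f(1) s in auto)
      moreover have "edge_point q extreme_point_of D"
        using f(2) [OF that] by (simp add: simplex_graph_def)
      ultimately have "edge_point q extreme_point_of (D \<inter> D')"
        using extreme_point_of_face face(1) by blast
      then show ?thesis
        using extreme_point_of_face face(2) by (auto simp: simplex_graph_def)
    qed
    then have "q \<in> simplex_graph D'" if "f q - f' q \<noteq> 0" for q
      using that f'(2) [of q] by fastforce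
    then have "f p - f' p = 0"
      by (rule zero_margins_imp_zero [OF T D(2), of "\<lambda>p. f p - f' p"])
        (use eq in \<open>auto simp: scaleR_left_diff_distrib sum_subtractf\<close>)
    then show ?thesis by simp
  qed
qed

section \<open>Forests\<close>

text \<open>Degree count with \<open>W\<close> as the set of edges: if every vertex except
  \<open>r\<close> had degree at least 2, twice the number of vertices would be at most one more
  than twice the number of edges, against the forest inequality.\<close>

lemma forest_leaf:
  fixes ends :: "'w \<Rightarrow> 'v set"
  assumes W: "finite W" "W \<noteq> {}"
    and two: "\<And>w. w \<in> W \<Longrightarrow> card (ends w) = 2"
    and forest: "card W < card (\<Union>(ends ` W))"
  shows "\<exists>w\<in>W. \<exists>v\<in>ends w. v \<noteq> r \<and> (\<forall>w'\<in>W. v \<in> ends w' \<longrightarrow> w' = w)"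
proof (rule ccontr)
  assume no: "\<not> ?thesis"
  let ?V = "\<Union>(ends ` W)"
  let ?deg = "\<lambda>v. card {w \<in> W. v \<in> ends w}"
  have fin: "finite ?V" using W two by (auto intro: card_ge_0_finite)
  have deg1: "1 \<le> ?deg v" if "v \<in> ?V" for v
    using that W(1) by (auto simp: Suc_le_eq card_gt_0_iff)
  have deg2: "2 \<le> ?deg v" if v: "v \<in> ?V" "v \<noteq> r" for v
  proof (rule ccontr)
    assume "\<not> 2 \<le> ?deg v"
    then have "?deg v = 1" using deg1 [OF v(1)] by simp
    then obtain w where "{w \<in> W. v \<in> ends w} = {w}" by (auto simp: card_1_singleton_iff)
    then show False using no v(2) by blast
  qed
  have "(\<Sum>v\<in>?V. ?deg v) = (\<Sum>w\<in>W. 2)"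
  proof (rule sum_multicount_gen)
    have "{v \<in> ?V. v \<in> ends w} = ends w" if "w \<in> W" for w using that by blast
    then show "\<forall>w\<in>W. card {v \<in> ?V. v \<in> ends w} = 2" using two by simp
  qed (use fin W in auto)
  then have "(\<Sum>v\<in>?V. ?deg v) = 2 * card W" by simp
  moreover have "2 * card ?V \<le> Suc (\<Sum>v\<in>?V. ?deg v)"
  proof (cases "r \<in> ?V")
    case True
    have "(\<Sum>v\<in>?V - {r}. 2) \<le> (\<Sum>v\<in>?V - {r}. ?deg v)"
      by (rule sum_mono) (use deg2 in blast)
    moreover have "(\<Sum>v\<in>?V. ?deg v) = ?deg r + (\<Sum>v\<in>?V - {r}. ?deg v)"
      by (rule sum.remove [OF fin True])
    moreover have "card ?V = Suc (card (?V - {r}))"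
      by (rule card.remove [OF fin True])
    ultimately show ?thesis using deg1 [OF True] by simp
  next
    case False
    have "(\<Sum>v\<in>?V. 2) \<le> (\<Sum>v\<in>?V. ?deg v)"
      by (rule sum_mono) (use deg2 False in blast)
    then show ?thesis by simp
  qed
  ultimately show False using forest by simp
qed

text \<open>Remove a leaf edge, sign the rest by induction, and choose the sign at the leaf, which
  lies on no other edge, so as to cancel the other end.\<close>

lemma forest_signing:
  fixes ends :: "'w \<Rightarrow> 'v set" and a :: "'w \<Rightarrow> 'v \<Rightarrow> int"
  assumes "finite W"
    and "\<And>w. w \<in> W \<Longrightarrow> card (ends w) = 2"
    and "\<And>W'. W' \<subseteq> W \<Longrightarrow> W' \<noteq> {} \<Longrightarrow> card W' < card (\<Union>(ends ` W'))"
    and a: "\<And>w v. a w v \<in> {-1, 1}"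
  shows "\<exists>c. (\<forall>v. c v \<in> {-1, 1}) \<and> (\<forall>w\<in>W. (\<Sum>v\<in>ends w. a w v * c v) = 0)"
  using assms(1-3)
proof (induction W rule: finite_psubset_induct)
  case (psubset W)
  show ?case
  proof (cases "W = {}")
    case True
    then show ?thesis by (intro exI [of _ "\<lambda>_. 1"]) simp
  next
    case False
    obtain w v where vw: "w \<in> W" "v \<in> ends w" "\<forall>w'\<in>W. v \<in> ends w' \<longrightarrow> w' = w"
      using forest_leaf [OF psubset.hyps False psubset.prems(1) psubset.prems(2) [OF subset_refl False]]
      by blast
    have "\<exists>c. (\<forall>v. c v \<in> {-1, 1}) \<and> (\<forall>u\<in>W - {w}. (\<Sum>v\<in>ends u. a u v * c v) = 0)"
    proof (rule psubset.IH)
      show "W - {w} \<subset> W" using vw by blast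
      show "card (ends u) = 2" if "u \<in> W - {w}" for u using psubset.prems(1) that by blast
      show "card W' < card (\<Union>(ends ` W'))" if "W' \<subseteq> W - {w}" "W' \<noteq> {}" for W'
        using psubset.prems(2) [OF _ that(2)] that(1) by blast
    qed
    then obtain c where c: "\<forall>v. c v \<in> {-1, 1}" "\<forall>u\<in>W - {w}. (\<Sum>v\<in>ends u. a u v * c v) = 0"
      by blast
    obtain v' where v': "ends w = {v, v'}" "v \<noteq> v'"
    proof -
      obtain x y where "ends w = {x, y}" "x \<noteq> y"
        using psubset.prems(1) [OF vw(1)] unfolding card_2_iff by blast
      then show thesis using vw(2) that [of x] that [of y] by fastforce
    qed
    \<comment> \<open>As \<open>a w v\<close> squares to 1, this choice gives
      \<open>a w v * c' v = - a w v' * c v'\<close>.\<close>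
    define c' where "c' = c(v := - a w v * a w v' * c v')"
    have "c' u \<in> {-1, 1}" for u
      using c(1) [rule_format, of u] c(1) [rule_format, of v'] a [of w v] a [of w v']
      by (auto simp: c'_def)
    moreover have "(\<Sum>v\<in>ends u. a u v * c' v) = 0" if u: "u \<in> W" for u
    proof (cases "u = w")
      case True
      show ?thesis using v' a [of w v] by (auto simp: True c'_def)
    next
      case False
      then have "v \<notin> ends u" using vw(3) u by blast
      then have "(\<Sum>v\<in>ends u. a u v * c' v) = (\<Sum>v\<in>ends u. a u v * c v)"
        by (intro sum.cong) (auto simp: c'_def)
      then show ?thesis using c(2) False u by simp
    qed
    ultimately show ?thesis by blast
  qed
qed

text \<open>A leaf edge takes its leaf, which no other edge can claim, and induction does the rest.
  Avoiding \<open>r\<close> keeps that vertex free for one further partner.\<close>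

lemma forest_matching:
  fixes ends :: "'w \<Rightarrow> 'v set"
  assumes "finite W"
    and "\<And>w. w \<in> W \<Longrightarrow> card (ends w) = 2"
    and "\<And>W'. W' \<subseteq> W \<Longrightarrow> W' \<noteq> {} \<Longrightarrow> card W' < card (\<Union>(ends ` W'))"
  shows "\<exists>m. inj_on m W \<and> (\<forall>w\<in>W. m w \<in> ends w - {r})"
  using assms
proof (induction W rule: finite_psubset_induct)
  case (psubset W)
  show ?case
  proof (cases "W = {}")
    case True
    then show ?thesis by simp
  next
    case False
    obtain w v where vw: "w \<in> W" "v \<in> ends w" "v \<noteq> r" "\<forall>w'\<in>W. v \<in> ends w' \<longrightarrow> w' = w"
      using forest_leaf [OF psubset.hyps False psubset.prems(1) psubset.prems(2) [OF subset_refl False]]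
      by blast
    have "\<exists>m. inj_on m (W - {w}) \<and> (\<forall>u\<in>W - {w}. m u \<in> ends u - {r})"
    proof (rule psubset.IH)
      show "W - {w} \<subset> W" using vw by blast
      show "card (ends u) = 2" if "u \<in> W - {w}" for u using psubset.prems(1) that by blast
      show "card W' < card (\<Union>(ends ` W'))" if "W' \<subseteq> W - {w}" "W' \<noteq> {}" for W'
        using psubset.prems(2) [OF _ that(2)] that(1) by blast
    qed
    then obtain m where m: "inj_on m (W - {w})" "\<forall>u\<in>W - {w}. m u \<in> ends u - {r}"
      by blast
    have ne: "m u \<noteq> v" if "u \<in> W - {w}" for u
      using m(2) vw(4) that by auto
    have "inj_on (m(w := v)) W"
    proof (rule inj_onI)
      fix x y assume "x \<in> W" "y \<in> W" "(m(w := v)) x = (m(w := v)) y"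
      then show "x = y"
        using inj_onD [OF m(1), of x y] ne [of x] ne [of y] by (auto split: if_splits)
    qed
    moreover have "(m(w := v)) u \<in> ends u - {r}" if "u \<in> W" for u
      using m(2) vw(2,3) that by (cases "u = w") simp_all
    ultimately show ?thesis by blast
  qed
qed

section \<open>Orthogonality of circuits\<close>

lemma psi_values: "psi A S F j \<in> {-1, 0, 1}"
  by (simp add: psi_def Let_def)

lemma psi_edge_of_sign:
  fixes A :: "'r \<Rightarrow> 'e \<Rightarrow> int"
  assumes A: "\<And>i j. A i j \<in> {-1, 1}" and S: "\<And>i. S i \<in> {-1, 0, 1}"
    and F: "\<exists>i. (i, j) \<in> F" "\<And>i. (i, j) \<in> F \<Longrightarrow> S i \<noteq> 0"
    and t: "t \<in> {-1, 1}" "0 \<le> t * psi A S F j"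
  shows "\<exists>i. (i, j) \<in> F \<and> S i * A i j = t"
proof -
  let ?c = "\<lambda>i. signed_restriction A S F i j"
  have c: "?c i \<in> {-1, 0, 1}" for i
    using A [of i j] S [of i] by (auto simp: signed_restriction_def)
  obtain i0 where i0: "(i0, j) \<in> F" using F(1) by blast
  have "?c i0 \<noteq> 0"
    using i0 F(2) [OF i0] A [of i0 j] by (auto simp: signed_restriction_def)
  have "\<exists>i. ?c i = t"
  proof (rule ccontr)
    assume no: "\<not> ?thesis"
    then have neg: "?c i \<in> {0, - t}" for i using c [of i] t(1) by auto
    with \<open>?c i0 \<noteq> 0\<close> have "?c i0 = - t" by blast
    show False
    proof (cases "t = 1")
      case True
      then have "?c i \<le> 0" for i using neg [of i] by auto
      moreover have "?c i0 < 0" using \<open>?c i0 = - t\<close> True by simp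
      ultimately have "\<not> (\<exists>i. ?c i > 0)" "\<not> (\<forall>i. ?c i = 0)" "\<not> (\<forall>i. ?c i \<ge> 0)"
        by (simp add: not_less, metis less_irrefl, metis not_less)
      then have "psi A S F j = -1" unfolding psi_def Let_def by simp
      then show False using t(2) True by simp
    next
      case False
      then have t': "t = -1" using t(1) by simp
      then have "?c i \<ge> 0" for i using neg [of i] by auto
      moreover have "?c i0 > 0" using \<open>?c i0 = - t\<close> t' by simp
      ultimately have "\<not> (\<exists>i. ?c i < 0)" "\<not> (\<forall>i. ?c i = 0)" "\<forall>i. ?c i \<ge> 0"
        by (simp add: not_less, metis less_irrefl, simp)
      then have "psi A S F j = 1" unfolding psi_def Let_def by simp
      then show False using t(2) t' by simp
    qed
  qed
  then obtain i where "?c i = t" by blast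
  then have "(i, j) \<in> F \<and> S i * A i j = t"
    using t(1) by (auto simp: signed_restriction_def split: if_splits)
  then show ?thesis by blast
qed

text \<open>A circuit is given by a tree certificate: in one tree every row meets both signs of
  \<open>A i j * X j\<close>. This form supplies exactly the edges that the alternating walks below
  need.\<close>

definition matched_circuits ::
  "((real ^ 'r::finite) \<times> (real ^ 'e::finite)) set set \<Rightarrow> ('r \<Rightarrow> 'e \<Rightarrow> int) \<Rightarrow> ('e \<Rightarrow> int) set"
  where "matched_circuits \<T> A = {X. (\<forall>j. X j \<in> {-1, 0, 1}) \<and>
    (\<exists>D\<in>\<T>. \<forall>i. \<forall>t\<in>{-1, 1}. \<exists>j. (i, j) \<in> simplex_graph D \<and> A i j * X j = t)}"

text \<open>If no product is negative, each \<open>j\<close> in the support of \<open>X\<close> has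
  an edge of \<open>F\<close> to a row \<open>i\<close> with \<open>S i * A i j * X j = 1\<close>,
  and that row has an edge of the circuit tree with value -1. Following these edges closes up, and
  uniqueness of flows then gives one edge both values.\<close>

lemma psi_orthogonal_circuit:
  fixes \<T> :: "((real ^ 'r::finite) \<times> (real ^ 'e::finite)) set set"
  assumes T: "product_triangulation \<T>"
    and A: "\<And>i j. A i j \<in> {-1, 1}"
    and F: "covector_pd_graph \<T> F"
    and S: "\<And>i. S i \<in> {-1, 0, 1}" "\<And>i j. (i, j) \<in> F \<Longrightarrow> S i \<noteq> 0"
    and X: "X \<in> matched_circuits \<T> A"
  shows "\<exists>j. X j * psi A S F j < 0"
proof (rule ccontr)
  assume "\<not> ?thesis"
  then have nonneg: "0 \<le> X j * psi A S F j" for j by (simp add: not_less)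
  obtain D where D: "D \<in> \<T>" "F \<subseteq> simplex_graph D" and Fcol: "\<And>j. \<exists>i. (i, j) \<in> F"
    using F unfolding covector_pd_graph_def by blast
  obtain D' where D': "D' \<in> \<T>"
    "\<And>i t. t \<in> {-1, 1} \<Longrightarrow> \<exists>j. (i, j) \<in> simplex_graph D' \<and> A i j * X j = t"
    and Xv: "\<And>j. X j \<in> {-1, 0, 1}"
    using X unfolding matched_circuits_def by blast
  have "\<exists>i. (i, j) \<in> F \<and> S i * A i j * X j = 1" if "X j \<noteq> 0" for j
  proof -
    have t: "X j \<in> {-1, 1}" using Xv [of j] that by auto
    obtain i where "(i, j) \<in> F" "S i * A i j = X j"
      using psi_edge_of_sign [of A S j F "X j", OF A S(1) Fcol _ t nonneg] S(2) by blast
    then show ?thesis using t by (intro exI [of _ i]) auto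
  qed
  then obtain \<phi> where \<phi>: "\<And>j. X j \<noteq> 0 \<Longrightarrow> (\<phi> j, j) \<in> F \<and> S (\<phi> j) * A (\<phi> j) j * X j = 1"
    by metis
  have "\<exists>j. (i, j) \<in> simplex_graph D' \<and> S i * A i j * X j = -1" if "S i \<noteq> 0" for i
  proof -
    have t: "- S i \<in> {-1, 1}" using S(1) [of i] that by auto
    then obtain j where j: "(i, j) \<in> simplex_graph D'" "A i j * X j = - S i" using D'(2) [OF t] by blast
    then have "S i * A i j * X j = S i * (- S i)" by (simp add: mult.assoc)
    then show ?thesis using t j(1) by (intro exI [of _ j]) auto
  qed
  then obtain \<kappa> where \<kappa>: "\<And>i. S i \<noteq> 0 \<Longrightarrow> (i, \<kappa> i) \<in> simplex_graph D' \<and> S i * A i (\<kappa> i) * X (\<kappa> i) = -1"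
    by metis
  define h where "h j = \<kappa> (\<phi> j)" for j
  have S\<phi>: "S (\<phi> j) \<noteq> 0" if "X j \<noteq> 0" for j using \<phi> [OF that] by auto
  have hX: "X (h j) \<noteq> 0" if "X j \<noteq> 0" for j using \<kappa> [OF S\<phi> [OF that]] by (auto simp: h_def)
  \<comment> \<open>\<open>P\<close> describes the non-empty sets of support columns closed under
    \<open>h\<close>. On one of least size \<open>h\<close> is a permutation, because the image is
    again such a set; this replaces the choice of a single cycle.\<close>
  define P where "P U \<longleftrightarrow> U \<noteq> {} \<and> U \<subseteq> {j. X j \<noteq> 0} \<and> h ` U \<subseteq> U" for U
  have "P {j. X j \<noteq> 0}"
    using D'(2) [of 1] hX by (fastforce simp: P_def)
  then obtain U where U: "P U" "\<forall>V. P V \<longrightarrow> card U \<le> card V"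
    using ex_has_least_nat [of P _ card] by blast
  have "P (h ` U)" using U(1) unfolding P_def by auto
  then have "card U \<le> card (h ` U)" using U(2) by blast
  moreover have "h ` U \<subseteq> U" using U(1) by (simp add: P_def)
  ultimately have hU: "h ` U = U" by (intro card_seteq finite)
  then have "inj_on h U" by (intro eq_card_imp_inj_on) simp_all
  then have bij: "bij_betw h U U" by (simp add: bij_betw_def hU)
  have UX: "X j \<noteq> 0" if "j \<in> U" for j using U(1) that unfolding P_def by blast
  \<comment> \<open>The edges \<open>(\<phi> j, j)\<close> of \<open>F\<close> and the edges \<open>(\<phi> j, h j)\<close> of the circuit form closed
    alternating walks, so they carry flows with the same margins.\<close>
  define f :: "'r \<times> 'e \<Rightarrow> real" where "f p = (\<Sum>j\<in>U. if p = (\<phi> j, j) then 1 else 0)" for p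
  define f' :: "'r \<times> 'e \<Rightarrow> real" where "f' p = (\<Sum>j\<in>U. if p = (\<phi> j, h j) then 1 else 0)" for p
  have supp: "\<exists>j\<in>U. p = (\<phi> j, k j)" if "(\<Sum>j\<in>U. if p = (\<phi> j, k j) then 1 else 0 :: real) \<noteq> 0" for p k
  proof (rule ccontr)
    assume "\<not> ?thesis"
    then have "(\<Sum>j\<in>U. if p = (\<phi> j, k j) then 1 else 0 :: real) = 0" by (intro sum.neutral) auto
    then show False using that by simp
  qed
  have row: "(\<Sum>l\<in>UNIV. \<Sum>j\<in>U. if (i, l) = (\<phi> j, k j) then 1 else 0 :: real)
      = (\<Sum>j\<in>U. if i = \<phi> j then 1 else 0)" for i and k :: "'e \<Rightarrow> 'e"
    by (subst sum.swap) (auto intro!: sum.cong)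
  have col: "(\<Sum>i\<in>UNIV. \<Sum>j\<in>U. if (i, l) = (\<phi> j, k j) then 1 else 0 :: real)
      = (\<Sum>j\<in>U. if l = k j then 1 else 0)" for l and k :: "'e \<Rightarrow> 'e"
    by (subst sum.swap) (auto intro!: sum.cong)
  have "f p = f' p" for p
  proof (rule flow_unique [OF T D(1) D'(1)])
    fix p
    show "0 \<le> f p" "0 \<le> f' p" by (auto simp: f_def f'_def intro: sum_nonneg)
    show "p \<in> simplex_graph D" if "f p \<noteq> 0"
      using supp [of p "\<lambda>j. j"] that \<phi> UX D(2) unfolding f_def by blast
    show "p \<in> simplex_graph D'" if "f' p \<noteq> 0"
      using supp [of p h] that \<kappa> S\<phi> UX unfolding f'_def h_def by blast
  next
    fix i show "(\<Sum>j\<in>UNIV. f (i, j)) = (\<Sum>j\<in>UNIV. f' (i, j))"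
      unfolding f_def f'_def row ..
  next
    fix l
    have "(\<Sum>j\<in>U. if l = h j then 1 else 0 :: real) = (\<Sum>j\<in>U. if l = j then 1 else 0)"
      by (rule sum.reindex_bij_betw [OF bij])
    then show "(\<Sum>i\<in>UNIV. f (i, l)) = (\<Sum>i\<in>UNIV. f' (i, l))"
      unfolding f_def f'_def col by simp
  qed
  moreover obtain u where u: "u \<in> U" using U(1) unfolding P_def by blast
  moreover have "f (\<phi> u, u) \<noteq> 0"
    using u unfolding f_def by (subst sum_nonneg_eq_0_iff) auto
  \<comment> \<open>So the edge of \<open>F\<close> at \<open>u\<close> is also a circuit edge
    \<open>(\<phi> v, h v)\<close>; the former has value 1 and the latter -1.\<close>
  ultimately have "f' (\<phi> u, u) \<noteq> 0" by metis
  then obtain v where v: "v \<in> U" "\<phi> u = \<phi> v" "u = h v"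
    using supp [of "(\<phi> u, u)" h] unfolding f'_def by auto
  have "S (\<phi> v) * A (\<phi> v) (h v) * X (h v) = -1"
    using \<kappa> [OF S\<phi> [OF UX [OF v(1)]]] by (simp add: h_def)
  then show False using \<phi> [OF UX [OF u]] v by simp
qed

section \<open>Trees with prescribed degrees\<close>

lemma two_le_card_support:
  fixes f :: "'a::finite \<Rightarrow> real"
  assumes "\<And>a. f a < sum f UNIV"
  shows "2 \<le> card {a. f a \<noteq> 0}"
proof (rule ccontr)
  assume "\<not> ?thesis"
  then consider "card {a. f a \<noteq> 0} = 0" | "card {a. f a \<noteq> 0} = 1" by linarith
  then show False
  proof cases
    case 1
    then have "f a = 0" for a by auto
    then show False using assms by simp
  next
    case 2
    then obtain a where a: "{a. f a \<noteq> 0} = {a}" by (auto simp: card_1_singleton_iff)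
    have "sum f UNIV = sum f {a. f a \<noteq> 0}" by (rule sum.mono_neutral_right) auto
    then show False using assms [of a] unfolding a by simp
  qed
qed

text \<open>Row sums \<open>d + 1\<close> and column sums \<open>d\<close> on \<open>\<rho>\<close>
  have the same total. No single entry fills a row, so each row has at least two edges, and the
  forest bound leaves room for no more. Rows then act as edges of a forest on \<open>\<rho>\<close>,
  which can be signed.\<close>

lemma matched_circuit_exists:
  fixes \<T> :: "((real ^ 'r::finite) \<times> (real ^ 'e::finite)) set set"
  assumes T: "product_triangulation \<T>"
    and A: "\<And>i j. A i j \<in> {-1, 1}"
    and \<rho>: "card \<rho> = Suc CARD('r)"
  shows "\<exists>X\<in>matched_circuits \<T> A. \<forall>j. X j \<noteq> 0 \<longleftrightarrow> j \<in> \<rho>"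
proof -
  let ?d = "real CARD('r)"
  have "\<exists>D\<in>\<T>. \<exists>f. (\<forall>p. 0 \<le> f p) \<and> (\<forall>p. f p \<noteq> 0 \<longrightarrow> p \<in> simplex_graph D) \<and>
    (\<forall>i. (\<Sum>j\<in>UNIV. f (i, j)) = ?d + 1) \<and> (\<forall>j. (\<Sum>i\<in>UNIV. f (i, j)) = (if j \<in> \<rho> then ?d else 0))"
  proof (rule flow_exists [OF T, where s = "?d * (?d + 1)"])
    show "(\<Sum>j\<in>UNIV. if j \<in> \<rho> then ?d else 0) = ?d * (?d + 1)"
      using \<rho> by (simp add: sum.If_cases algebra_simps)
    show "0 < ?d * (?d + 1)" by (intro mult_pos_pos add_pos_pos) simp_all
  qed simp_all
  then obtain D f where D: "D \<in> \<T>" and f: "\<And>p. 0 \<le> f p" "\<And>p. f p \<noteq> 0 \<Longrightarrow> p \<in> simplex_graph D"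
    and row: "\<And>i. (\<Sum>j\<in>UNIV. f (i, j)) = ?d + 1"
    and col: "\<And>j. (\<Sum>i\<in>UNIV. f (i, j)) = (if j \<in> \<rho> then ?d else 0)"
    by metis
  define N where "N i = {j. f (i, j) \<noteq> 0}" for i
  have le_col: "f (i, j) \<le> (if j \<in> \<rho> then ?d else 0)" for i j
    using member_le_sum [of i UNIV "\<lambda>i. f (i, j)"] f(1) col [of j] by simp
  have N_sub: "N i \<subseteq> \<rho>" for i
  proof
    fix j assume "j \<in> N i"
    then have "0 < f (i, j)" using f(1) [of "(i, j)"] by (simp add: N_def order_less_le)
    then show "j \<in> \<rho>" using le_col [of i j] by (auto split: if_splits)
  qed
  have N2: "2 \<le> card (N i)" for i
    unfolding N_def
  proof (rule two_le_card_support)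
    fix j show "f (i, j) < (\<Sum>j\<in>UNIV. f (i, j))"
      using le_col [of i j] row [of i] by (auto split: if_splits)
  qed
  have forest: "(\<Sum>i\<in>I. card (N i)) < card I + card (\<Union>(N ` I))" if "I \<noteq> {}" for I
  proof -
    have ne: "N i \<noteq> {}" for i using N2 [of i] by auto
    have eqs: "fst ` Sigma I N = I" "snd ` Sigma I N = \<Union>(N ` I)"
      "card (Sigma I N) = (\<Sum>i\<in>I. card (N i))"
      using ne by (force simp: image_iff)+
    have "card (Sigma I N) < card (fst ` Sigma I N) + card (snd ` Sigma I N)"
    proof (rule card_edges_less [OF T D])
      show "Sigma I N \<subseteq> simplex_graph D" using f(2) by (auto simp: N_def)
      show "Sigma I N \<noteq> {}" using that ne by (auto simp: Sigma_empty_iff)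
    qed
    then show ?thesis unfolding eqs .
  qed
  \<comment> \<open>At most \<open>d + 1\<close> columns carry flow, so strictness of the forest
    bound leaves at most \<open>2 * d\<close> edges for the \<open>d\<close> rows.\<close>
  have "card (\<Union>(range N)) \<le> Suc CARD('r)"
    using N_sub \<rho> by (metis UN_least card_mono finite)
  then have "(\<Sum>i\<in>UNIV. card (N i)) \<le> (\<Sum>i\<in>(UNIV :: 'r set). 2)"
    using forest [of UNIV] by simp
  moreover have "(\<Sum>i\<in>(UNIV :: 'r set). 2) \<le> (\<Sum>i\<in>UNIV. card (N i))"
    by (rule sum_mono) (rule N2)
  ultimately have "(\<Sum>i\<in>(UNIV :: 'r set). 2) = (\<Sum>i\<in>UNIV. card (N i))" by linarith
  then have two: "card (N i) = 2" for i
    using sum_mono_inv [of "\<lambda>i. 2" UNIV "\<lambda>i. card (N i)" i] N2 by simp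
  \<comment> \<open>The two terms of each row cancel, so one is 1 and the other -1: every row sees
    both signs.\<close>
  have "\<exists>c. (\<forall>j. c j \<in> {-1, 1}) \<and> (\<forall>i\<in>UNIV. (\<Sum>j\<in>N i. A i j * c j) = 0)"
  proof (rule forest_signing)
    show "card I < card (\<Union>(N ` I))" if "I \<noteq> {}" for I
      using forest [OF that] two by simp
  qed (use two A in simp_all)
  then obtain c where c: "\<forall>j. c j \<in> {-1, 1}" "\<forall>i\<in>UNIV. (\<Sum>j\<in>N i. A i j * c j) = 0"
    by (elim exE conjE)
  define X where "X j = (if j \<in> \<rho> then c j else 0)" for j
  have K: "\<exists>j. (i, j) \<in> simplex_graph D \<and> A i j * X j = t" if t: "t \<in> {-1, 1}" for i t
  proof -
    obtain j j' where j: "N i = {j, j'}" "j \<noteq> j'" using two [of i] unfolding card_2_iff by blast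
    then have 0: "A i j * c j + A i j' * c j' = 0" using c(2) [rule_format, of i] by simp
    have jN: "j \<in> N i" "j' \<in> N i" by (simp_all add: j)
    then have "(i, j) \<in> simplex_graph D" "(i, j') \<in> simplex_graph D"
      by (simp_all add: N_def f(2))
    moreover have "X j = c j" "X j' = c j'"
      using subsetD [OF N_sub jN(1)] subsetD [OF N_sub jN(2)] by (simp_all add: X_def)
    ultimately have mem: "(i, j) \<in> simplex_graph D" "(i, j') \<in> simplex_graph D" "X j = c j" "X j' = c j'"
      by simp_all
    have "A i j * c j = t \<or> A i j' * c j' = t"
      using 0 t A [of i j] A [of i j'] c(1) [rule_format, of j] c(1) [rule_format, of j'] by auto
    then show ?thesis using mem by metis
  qed
  have "X j \<in> {-1, 0, 1}" for j using c(1) [rule_format, of j] by (auto simp: X_def)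
  then have "X \<in> matched_circuits \<T> A"
    unfolding matched_circuits_def by (intro CollectI conjI allI bexI [OF _ D] ballI K)
  moreover have "X j \<noteq> 0 \<longleftrightarrow> j \<in> \<rho>" for j
    using c(1) [rule_format, of j] by (auto simp: X_def)
  ultimately show ?thesis by blast
qed

lemma card_columns_less:
  fixes N :: "'e::finite \<Rightarrow> 'r::finite set"
  assumes T: "product_triangulation \<T>" and D: "D \<in> \<T>"
    and N: "\<And>i j. i \<in> N j \<Longrightarrow> (i, j) \<in> simplex_graph D" "\<And>j. j \<in> J \<Longrightarrow> N j \<noteq> {}"
    and J: "J \<noteq> {}"
  shows "(\<Sum>j\<in>J. card (N j)) < card J + card (\<Union>(N ` J))"
proof -
  let ?H = "(\<lambda>(j, i). (i, j)) ` Sigma J N"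
  have "inj_on (\<lambda>(j, i). (i, j)) (Sigma J N)" by (auto simp: inj_on_def)
  then have "card ?H = card (Sigma J N)" by (rule card_image)
  then have eqs: "card ?H = (\<Sum>j\<in>J. card (N j))" "fst ` ?H = \<Union>(N ` J)" "snd ` ?H = J"
    using N(2) by (force simp: image_iff)+
  have "card ?H < card (fst ` ?H) + card (snd ` ?H)"
  proof (rule card_edges_less [OF T D])
    show "?H \<subseteq> simplex_graph D" using N(1) by auto
    show "?H \<noteq> {}" using J N(2) by (auto simp: Sigma_empty_iff)
  qed
  then show ?thesis unfolding eqs by simp
qed

text \<open>Columns of \<open>\<tau>\<close> are made so heavy that they need two rows, and every
  other column needs at least one. This already makes \<open>n + d - 1\<close> edges, the maximum
  for a forest on \<open>n + d\<close> nodes, so all the lower bounds are attained.\<close>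

lemma cocircuit_tree_exists:
  fixes \<T> :: "((real ^ 'r::finite) \<times> (real ^ 'e::finite)) set set"
  assumes T: "product_triangulation \<T>"
    and de: "CARD('r) \<le> CARD('e)" and \<tau>: "Suc (card \<tau>) = CARD('r)"
  shows "\<exists>D\<in>\<T>. \<exists>N. (\<forall>i j. i \<in> N j \<longrightarrow> (i, j) \<in> simplex_graph D) \<and>
    (\<forall>j. card (N j) = (if j \<in> \<tau> then 2 else 1))"
proof -
  let ?d = "real CARD('r)" and ?m = "real CARD('e) - real CARD('r) + 1"
  \<comment> \<open>\<open>b\<close> exceeds the number \<open>?m\<close> of columns outside
    \<open>\<tau>\<close>. Hence the column sum \<open>?d * b\<close> is larger than the common row
    sum, and no single row can fill a column of \<open>\<tau>\<close>.\<close>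
  define b where "b = real CARD('e) + 1"
  have d: "real (card \<tau>) = ?d - 1" "?d \<ge> 1" using \<tau> by linarith+
  have m: "?m \<ge> 1" using de by simp
  have compl: "card \<tau> + card (- \<tau>) = CARD('e)"
    using card_Un_disjoint [of \<tau> "- \<tau>"] by simp
  then have m': "real (card (- \<tau>)) = ?m" using \<tau> by linarith
  have "\<exists>D\<in>\<T>. \<exists>f. (\<forall>p. 0 \<le> f p) \<and> (\<forall>p. f p \<noteq> 0 \<longrightarrow> p \<in> simplex_graph D) \<and>
    (\<forall>i. (\<Sum>j\<in>UNIV. f (i, j)) = (?d - 1) * b + ?m / ?d) \<and>
    (\<forall>j. (\<Sum>i\<in>UNIV. f (i, j)) = (if j \<in> \<tau> then ?d * b else 1))"
  proof (rule flow_exists [OF T])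
    show "0 \<le> (?d - 1) * b + ?m / ?d" for i :: 'r
      using d m by (simp add: b_def)
    show "0 \<le> (if j \<in> \<tau> then ?d * b else 1)" for j by (simp add: b_def)
    show "(\<Sum>i\<in>(UNIV :: 'r set). (?d - 1) * b + ?m / ?d) = ?d * (?d - 1) * b + ?m"
      using d by (simp add: field_simps)
    show "(\<Sum>j\<in>UNIV. if j \<in> \<tau> then ?d * b else 1) = ?d * (?d - 1) * b + ?m"
      using d m' by (simp add: sum.If_cases Compl_eq [symmetric])
    show "0 < ?d * (?d - 1) * b + ?m"
      using d m by (intro add_nonneg_pos) (auto simp: b_def)
  qed
  then obtain D f where D: "D \<in> \<T>" and f: "\<And>p. 0 \<le> f p" "\<And>p. f p \<noteq> 0 \<Longrightarrow> p \<in> simplex_graph D"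
    and row: "\<And>i. (\<Sum>j\<in>UNIV. f (i, j)) = (?d - 1) * b + ?m / ?d"
    and col: "\<And>j. (\<Sum>i\<in>UNIV. f (i, j)) = (if j \<in> \<tau> then ?d * b else 1)"
    by metis
  define N where "N j = {i. f (i, j) \<noteq> 0}" for j
  have N2: "2 \<le> card (N j)" if j: "j \<in> \<tau>" for j
    unfolding N_def
  proof (rule two_le_card_support)
    fix i
    have "f (i, j) \<le> (?d - 1) * b + ?m / ?d"
      using member_le_sum [of j UNIV "\<lambda>j. f (i, j)"] f(1) row [of i] by simp
    also have "\<dots> \<le> (?d - 1) * b + ?m"
      using d(2) m by (simp add: divide_le_eq mult_left_le_imp_le)
    also have "\<dots> < ?d * b" using d by (simp add: b_def algebra_simps)
    finally show "f (i, j) < (\<Sum>i\<in>UNIV. f (i, j))" using col [of j] j by simp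
  qed
  have N1: "1 \<le> card (N j)" if "j \<notin> \<tau>" for j
  proof -
    have "N j \<noteq> {}"
    proof
      assume "N j = {}"
      then have "(\<Sum>i\<in>UNIV. f (i, j)) = 0" by (simp add: N_def)
      then show False using col [of j] that by simp
    qed
    then show ?thesis by (simp add: Suc_le_eq card_gt_0_iff)
  qed
  let ?c = "\<lambda>j. if j \<in> \<tau> then 2 else 1 :: nat"
  have cN: "?c j \<le> card (N j)" for j using N1 N2 by simp
  have N: "i \<in> N j \<longrightarrow> (i, j) \<in> simplex_graph D" for i j using f(2) by (simp add: N_def)
  have "N j \<noteq> {}" for j using N1 [of j] N2 [of j] by (cases "j \<in> \<tau>") auto
  then have "(\<Sum>j\<in>UNIV. card (N j)) < CARD('e) + card (\<Union>(range N))"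
    using card_columns_less [OF T D, of N UNIV] N by simp
  also have "\<dots> \<le> CARD('e) + CARD('r)" by (intro add_left_mono card_mono) auto
  finally have lt: "(\<Sum>j\<in>UNIV. card (N j)) < CARD('e) + CARD('r)" .
  have sumc: "(\<Sum>j\<in>UNIV. ?c j) = 2 * card \<tau> + card (- \<tau>)"
    by (simp add: sum.If_cases Compl_eq [symmetric])
  have "(\<Sum>j\<in>UNIV. ?c j) \<le> (\<Sum>j\<in>UNIV. card (N j))" by (rule sum_mono) (rule cN)
  then have "(\<Sum>j\<in>UNIV. ?c j) = (\<Sum>j\<in>UNIV. card (N j))"
    using lt sumc compl \<tau> by linarith
  then have "card (N j) = ?c j" for j
    using sum_mono_inv [of ?c UNIV "\<lambda>j. card (N j)" j] cN by simp
  then show ?thesis using N by (intro bexI [OF _ D] exI [of _ N] conjI allI)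
qed

section \<open>The chirotope as a determinant\<close>

lemma order_perm_permutes:
  fixes xs :: "'a::linorder list"
  assumes "distinct xs"
  shows "order_perm xs permutes {..<length xs}"
proof (rule bij_imp_permutes)
  have lt: "order_perm xs k < order_perm xs l"
    if "k < length xs" "l < length xs" "xs ! k < xs ! l" for k l
  proof -
    have "{y \<in> set xs. y < xs ! k} \<subset> {y \<in> set xs. y < xs ! l}"
    proof (rule psubsetI)
      show "{y \<in> set xs. y < xs ! k} \<subseteq> {y \<in> set xs. y < xs ! l}"
        by (intro subsetI CollectI conjI) (use that(3) less_trans in \<open>simp, fastforce\<close>)
      have "xs ! k \<in> {y \<in> set xs. y < xs ! l}" using that by simp
      moreover have "xs ! k \<notin> {y \<in> set xs. y < xs ! k}" by simp
      ultimately show "{y \<in> set xs. y < xs ! k} \<noteq> {y \<in> set xs. y < xs ! l}" by metis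
    qed
    then show ?thesis using that by (simp add: order_perm_def psubset_card_mono)
  qed
  have inj: "inj_on (order_perm xs) {..<length xs}"
  proof (rule inj_onI)
    fix k l assume kl: "k \<in> {..<length xs}" "l \<in> {..<length xs}" "order_perm xs k = order_perm xs l"
    then have "\<not> xs ! k < xs ! l" "\<not> xs ! l < xs ! k" using lt [of k l] lt [of l k] by auto
    then have "xs ! k = xs ! l" by simp
    then show "k = l" using kl assms by (simp add: nth_eq_iff_index_eq)
  qed
  moreover have "order_perm xs ` {..<length xs} \<subseteq> {..<length xs}"
  proof (rule image_subsetI)
    fix k assume k: "k \<in> {..<length xs}"
    have "card {y \<in> set xs. y < xs ! k} \<le> card (set xs - {xs ! k})" by (rule card_mono) auto
    also have "\<dots> < card (set xs)" using k by (intro card_Diff1_less) simp_all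
    finally have "card {y \<in> set xs. y < xs ! k} < card (set xs)" .
    then show "order_perm xs k \<in> {..<length xs}"
      using k assms by (simp add: order_perm_def distinct_card)
  qed
  ultimately show "bij_betw (order_perm xs) {..<length xs} {..<length xs}"
    by (simp add: bij_betw_def endo_inj_surj)
qed (simp add: order_perm_def)

text \<open>Reordering leaves the set of entries unchanged, so the ranks are only rearranged: the
  new \<open>order_perm\<close> is the old one after \<open>p\<close>.\<close>

lemma sign_order_perm_permute_list:
  fixes xs :: "'a::linorder list"
  assumes "distinct xs" "p permutes {..<length xs}"
  shows "sign (order_perm (permute_list p xs)) = sign (order_perm xs) * sign p"
proof -
  have "order_perm (permute_list p xs) k = (order_perm xs \<circ> p) k" for k
  proof (cases "k < length xs")
    case True
    then have "p k < length xs" using permutes_in_image [OF assms(2), of k] by simp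
    then show ?thesis using True assms(2) by (simp add: order_perm_def permute_list_nth)
  next
    case False
    then have "p k = k" using permutes_not_in [OF assms(2), of k] by simp
    then show ?thesis using False by (simp add: order_perm_def)
  qed
  then have "order_perm (permute_list p xs) = order_perm xs \<circ> p" by (rule ext)
  moreover have "permutation (order_perm xs)" "permutation p"
    using order_perm_permutes [OF assms(1)] assms(2) by (auto intro: permutes_imp_permutation)
  ultimately show ?thesis by (simp add: sign_compose)
qed

section \<open>Perfect matchings contained in trees\<close>

lemma perfect_matching_graph:
  assumes "bij_betw g UNIV \<sigma>"
  shows "perfect_matching (range (\<lambda>i. (i, g i))) \<sigma>"
  unfolding perfect_matching_def
proof (intro conjI allI ballI)
  show "range (\<lambda>i. (i, g i)) \<subseteq> UNIV \<times> \<sigma>"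
    using bij_betwE [OF assms] by auto
  show "\<exists>!j. (i, j) \<in> range (\<lambda>i. (i, g i))" for i by auto
  fix j assume "j \<in> \<sigma>"
  then obtain i where i: "j = g i" using bij_betw_imp_surj_on [OF assms] by auto
  show "\<exists>!i. (i, j) \<in> range (\<lambda>i. (i, g i))"
  proof (rule ex1I [of _ i])
    show "(i, j) \<in> range (\<lambda>i. (i, g i))" by (auto simp: i)
    show "i' = i" if "(i', j) \<in> range (\<lambda>i. (i, g i))" for i'
      using that i bij_betw_imp_inj_on [OF assms] by (auto dest: injD)
  qed
qed

lemma perfect_matching_partner:
  assumes "perfect_matching M \<sigma>"
  shows "M = range (\<lambda>i. (i, THE j. (i, j) \<in> M))" "bij_betw (\<lambda>i. THE j. (i, j) \<in> M) UNIV \<sigma>"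
proof -
  have M: "M \<subseteq> UNIV \<times> \<sigma>" "\<And>i. \<exists>!j. (i, j) \<in> M" "\<And>j. j \<in> \<sigma> \<Longrightarrow> \<exists>!i. (i, j) \<in> M"
    using assms unfolding perfect_matching_def by auto
  have mem: "(i, THE j. (i, j) \<in> M) \<in> M" for i by (rule theI' [OF M(2)])
  have the: "(THE j. (i, j) \<in> M) = j" if "(i, j) \<in> M" for i j
    by (rule the1_equality [OF M(2) that])
  show "M = range (\<lambda>i. (i, THE j. (i, j) \<in> M))"
  proof (intro equalityI subsetI)
    fix p assume "p \<in> M"
    then show "p \<in> range (\<lambda>i. (i, THE j. (i, j) \<in> M))" using the by (cases p) auto
  qed (use mem in auto)
  show "bij_betw (\<lambda>i. THE j. (i, j) \<in> M) UNIV \<sigma>"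
  proof (rule bij_betwI')
    show "((THE j. (i, j) \<in> M) = (THE j. (i', j) \<in> M)) = (i = i')" for i i'
    proof
      assume eq: "(THE j. (i, j) \<in> M) = (THE j. (i', j) \<in> M)"
      have "(THE j. (i, j) \<in> M) \<in> \<sigma>" using mem [of i] M(1) by auto
      from M(3) [OF this] show "i = i'" using mem [of i] mem [of i'] eq by auto
    qed simp
    show "(THE j. (i, j) \<in> M) \<in> \<sigma>" for i using mem [of i] M(1) by auto
    show "\<exists>i\<in>UNIV. j = (THE j. (i, j) \<in> M)" if "j \<in> \<sigma>" for j
      using M(3) [OF that] the by auto
  qed
qed

text \<open>The indicator of a perfect matching is a flow with all row sums 1 and column sums the
  indicator of \<open>\<sigma>\<close>, so uniqueness of flows applies, even across trees.\<close>

lemma perfect_matching_unique: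
  fixes M M' :: "('r::finite \<times> 'e::finite) set"
  assumes T: "product_triangulation \<T>" and D: "D \<in> \<T>" "D' \<in> \<T>"
    and M: "perfect_matching M \<sigma>" "M \<subseteq> simplex_graph D"
    and M': "perfect_matching M' \<sigma>" "M' \<subseteq> simplex_graph D'"
  shows "M = M'"
proof -
  have row: "(\<Sum>j\<in>UNIV. of_bool ((i, j) \<in> N) :: real) = 1" if N: "perfect_matching N \<sigma>"
    for N :: "('r \<times> 'e) set" and i
  proof -
    obtain j where "\<And>j'. (i, j') \<in> N \<longleftrightarrow> j' = j" using N unfolding perfect_matching_def by metis
    then show ?thesis by (simp add: of_bool_def)
  qed
  have col: "(\<Sum>i\<in>UNIV. of_bool ((i, j) \<in> N) :: real) = of_bool (j \<in> \<sigma>)"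
    if N: "perfect_matching N \<sigma>" for N :: "('r \<times> 'e) set" and j
  proof (cases "j \<in> \<sigma>")
    case True
    then obtain i where "\<And>i'. (i', j) \<in> N \<longleftrightarrow> i' = i" using N unfolding perfect_matching_def by metis
    then show ?thesis using True by (simp add: of_bool_def)
  next
    case False
    then have "\<And>i. (i, j) \<notin> N" using N unfolding perfect_matching_def by auto
    then show ?thesis using False by simp
  qed
  have "of_bool (p \<in> M) = (of_bool (p \<in> M') :: real)" for p
    by (rule flow_unique [OF T D])
      (use M M' in \<open>auto simp: row [OF M(1)] row [OF M'(1)] col [OF M(1)] col [OF M'(1)]\<close>)
  then show ?thesis by (auto simp: of_bool_eq_iff set_eq_iff)
qed

text \<open>By uniqueness, a single matching found inside a tree evaluates the definite description
  in \<open>matching_field\<close>.\<close>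

lemma matching_field_eq:
  fixes M :: "('r::finite \<times> 'e::finite) set"
  assumes "product_triangulation \<T>" "D \<in> \<T>" "perfect_matching M \<sigma>" "M \<subseteq> simplex_graph D"
  shows "matching_field \<T> \<sigma> = M"
  unfolding matching_field_def
proof (rule the_equality)
  show "perfect_matching M \<sigma> \<and> (\<exists>D\<in>\<T>. M \<subseteq> simplex_graph D)" using assms by auto
  show "M' = M" if "perfect_matching M' \<sigma> \<and> (\<exists>D\<in>\<T>. M' \<subseteq> simplex_graph D)" for M'
    using that perfect_matching_unique [OF assms(1) _ assms(2) _ _ assms(3,4)] by auto
qed

text \<open>A non-zero term of the Leibniz expansion is a perfect matching inside \<open>G\<close>,
  and only \<open>M\<close> is one, so a single signed product survives. This form opens the
  chirotope to Cramer's rule.\<close>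

lemma alternating_extension_eq_det:
  fixes \<T> :: "((real ^ 'r::{finite,linorder}) \<times> (real ^ 'e::{finite,linorder})) set set"
    and A :: "'r \<Rightarrow> 'e \<Rightarrow> int"
  assumes ys: "distinct ys" "length ys = CARD('r)"
    and M: "perfect_matching M (set ys)" "M \<subseteq> G" "matching_field \<T> (set ys) = M"
    and uniq: "\<And>M'. perfect_matching M' (set ys) \<Longrightarrow> M' \<subseteq> G \<Longrightarrow> M' = M"
    and rs: "rs = sorted_list_of_set (UNIV :: 'r set)"
  shows "alternating_extension (matching_chirotope \<T> A) ys
    = det (mat CARD('r) CARD('r) (\<lambda>(k, l). if (rs ! k, ys ! l) \<in> G then A (rs ! k) (ys ! l) else 0))"
    (is "_ = det ?B")
proof -
  let ?d = "CARD('r)"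
  define g where "g = (\<lambda>i. THE j. (i, j) \<in> M)"
  have Mg: "M = range (\<lambda>i. (i, g i))" and g: "bij_betw g UNIV (set ys)"
    unfolding g_def by (fact perfect_matching_partner [OF M(1)])+
  have rs': "distinct rs" "set rs = UNIV" "length rs = ?d"
    using sorted_list_of_set.length_sorted_key_list_of_set [of "UNIV :: 'r set"] by (simp_all add: rs)
  have "distinct (map g rs)" "set (map g rs) = set ys"
    using rs' bij_betw_imp_inj_on [OF g] bij_betw_imp_surj_on [OF g] by (auto simp: distinct_map)
  then have "mset (map g rs) = mset ys" using ys(1) set_eq_iff_mset_eq_distinct by blast
  \<comment> \<open>\<open>q\<close> sends the position of a row to the position of its partner in
    \<open>ys\<close>; it indexes the surviving term.\<close>
  then obtain q where q: "q permutes {..<length ys}" "permute_list q ys = map g rs"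
    by (rule mset_eq_permutation)
  have gq: "g (rs ! k) = ys ! q k" if "k < ?d" for k
    using permute_list_nth [OF q(1), of k] that ys(2) rs'(3) by (simp add: q(2))
  have bij_rs: "bij_betw ((!) rs) {0..<?d} UNIV"
    using bij_betw_nth [OF rs'(1), of "{0..<?d}" UNIV] rs' by (simp add: atLeast0LessThan)
  have "(\<Prod>(i, j)\<in>M. A i j) = (\<Prod>i\<in>UNIV. A i (g i))"
    unfolding Mg by (subst prod.reindex) (auto simp: inj_on_def)
  also have "\<dots> = (\<Prod>k\<in>{0..<?d}. A (rs ! k) (g (rs ! k)))"
    by (rule prod.reindex_bij_betw [OF bij_rs, symmetric])
  also have "\<dots> = (\<Prod>k\<in>{0..<?d}. A (rs ! k) (ys ! q k))"
    by (intro prod.cong) (simp_all add: gq)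
  finally have prod: "(\<Prod>(i, j)\<in>M. A i j) = (\<Prod>k\<in>{0..<?d}. A (rs ! k) (ys ! q k))" .
  have "matching_sign M = sign (order_perm ys) * sign q"
    unfolding matching_sign_def g_def [symmetric] rs [symmetric] q(2) [symmetric]
    by (rule sign_order_perm_permute_list [OF ys(1) q(1)])
  \<comment> \<open>The sign of \<open>order_perm ys\<close> enters twice, through the matching and
    through the alternating extension, and cancels.\<close>
  then have chi: "alternating_extension (matching_chirotope \<T> A) ys
      = sign q * (\<Prod>k\<in>{0..<?d}. A (rs ! k) (ys ! q k))"
    using ys(1) by (simp add: alternating_extension_def matching_chirotope_def M(3) prod
        sign_idempotent flip: mult.assoc)
  let ?f = "\<lambda>p. of_int (sign p) * (\<Prod>k\<in>{0..<?d}. ?B $$ (k, p k)) :: int"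
  have q': "q permutes {0..<?d}" using q(1) ys(2) by (simp add: atLeast0LessThan)
  have zero: "?f p = 0" if p: "p permutes {0..<?d}" "p \<noteq> q" for p
  proof (rule ccontr)
    assume "?f p \<noteq> 0"
    then have "(\<Prod>k\<in>{0..<?d}. ?B $$ (k, p k)) \<noteq> 0" by simp
    then have ne: "?B $$ (k, p k) \<noteq> 0" if "k < ?d" for k using that by (simp add: prod_zero_iff)
    have p_lt: "p k < ?d" if "k < ?d" for k using permutes_in_image [OF p(1), of k] that by simp
    have pG: "(rs ! k, ys ! p k) \<in> G" if "k < ?d" for k
      using ne [OF that] p_lt [OF that] that by (auto split: if_splits)
    define idx where "idx = inv_into {0..<?d} ((!) rs)"
    have idx: "bij_betw idx UNIV {0..<?d}" unfolding idx_def by (rule bij_betw_inv_into [OF bij_rs])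
    have rs_idx: "rs ! idx i = i" for i
      unfolding idx_def using bij_betw_inv_into_right [OF bij_rs, of i] by simp
    have idx_lt: "idx i < ?d" for i using bij_betwE [OF idx] by simp
    \<comment> \<open>The matching encoded by \<open>p\<close>: a row goes to its position, then
      through \<open>p\<close> to a position in \<open>ys\<close>.\<close>
    define h where "h = (!) ys \<circ> (p \<circ> idx)"
    have "bij_betw ((!) ys) {0..<?d} (set ys)"
      using bij_betw_nth [OF ys(1), of "{0..<?d}" "set ys"] ys(2) by (simp add: atLeast0LessThan)
    then have "bij_betw h UNIV (set ys)"
      unfolding h_def by (intro bij_betw_trans [OF bij_betw_trans [OF idx permutes_imp_bij [OF p(1)]]])
    then have "perfect_matching (range (\<lambda>i. (i, h i))) (set ys)" by (rule perfect_matching_graph)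
    moreover have "(i, h i) \<in> G" for i
      using pG [OF idx_lt [of i]] by (simp add: h_def rs_idx)
    then have "range (\<lambda>i. (i, h i)) \<subseteq> G" by auto
    ultimately have "range (\<lambda>i. (i, h i)) = range (\<lambda>i. (i, g i))" using uniq Mg by simp
    then have hg: "h i = g i" for i by auto
    have "p k = q k" for k
    proof (cases "k < ?d")
      case True
      have "idx (rs ! k) = k"
        unfolding idx_def using True bij_betw_inv_into_left [OF bij_rs, of k] by simp
      then have "ys ! p k = ys ! q k" using hg [of "rs ! k"] gq [OF True] by (simp add: h_def)
      moreover have "q k < ?d" using permutes_in_image [OF q', of k] True by simp
      ultimately show ?thesis using p_lt [OF True] ys by (simp add: nth_eq_iff_index_eq)
    next
      case False
      then show ?thesis using permutes_not_in [OF p(1), of k] permutes_not_in [OF q', of k] by simp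
    qed
    then show False using p(2) by auto
  qed
  have "det ?B = (\<Sum>p | p permutes {0..<?d}. ?f p)" by (rule det_def') simp
  also have "\<dots> = (\<Sum>p\<in>{q}. ?f p)"
    by (rule sum.mono_neutral_right) (use q' zero in \<open>auto simp: finite_permutations\<close>)
  also have "\<dots> = sign q * (\<Prod>k\<in>{0..<?d}. A (rs ! k) (ys ! q k))"
  proof -
    have "?B $$ (k, q k) = A (rs ! k) (ys ! q k)" if k: "k < ?d" for k
    proof -
      have "(rs ! k, g (rs ! k)) \<in> M" unfolding Mg by (rule rangeI)
      then have "(rs ! k, ys ! q k) \<in> G" using subsetD [OF M(2)] gq [OF k] by simp
      then show ?thesis using k permutes_in_image [OF q', of k] by simp
    qed
    then show ?thesis by simp
  qed
  finally show ?thesis using chi by simp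
qed

section \<open>Cocircuits from trees by Cramer's rule\<close>

lemma sum_mult_cofactor:
  fixes B :: "'a::comm_ring_1 mat"
  assumes "B \<in> carrier_mat n n" "k < n" "k' < n"
  shows "(\<Sum>l<n. B $$ (k, l) * cofactor B k' l) = (if k = k' then det B else 0)"
proof -
  have "(\<Sum>l<n. B $$ (k, l) * cofactor B k' l) = (B * adj_mat B) $$ (k, k')"
    unfolding times_mat_def scalar_prod_def adj_mat_def using assms
    by (auto intro!: sum.cong simp: atLeast0LessThan)
  then show ?thesis using assms by (simp add: adj_mat(2) [OF assms(1)])
qed

text \<open>In a tree with two rows at each column of \<open>\<tau>\<close> and one elsewhere,
  \<open>S\<close> is chosen to cancel the columns of \<open>\<tau>\<close>. Then
  \<open>psi A S G\<close> is a combination of the rows of \<open>B e\<close> that vanishes on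
  \<open>\<tau>\<close>, and Cramer's rule shows it to be a constant sign times
  \<open>e \<mapsto> ?chi (e # xs)\<close>.\<close>

lemma tree_cocircuit_exists:
  fixes \<T> :: "((real ^ 'r::{finite,linorder}) \<times> (real ^ 'e::{finite,linorder})) set set"
    and A :: "'r \<Rightarrow> 'e \<Rightarrow> int"
  assumes T: "product_triangulation \<T>"
    and A: "\<And>i j. A i j \<in> {-1, 1}"
    and de: "CARD('r) \<le> CARD('e)" and \<tau>: "Suc (card \<tau>) = CARD('r)"
  shows "\<exists>S G. covector_pd_graph \<T> G \<and> (\<forall>i. S i \<in> {-1, 1}) \<and> (\<forall>j. psi A S G j = 0 \<longleftrightarrow> j \<in> \<tau>) \<and>
    psi A S G \<in> signed_cocircuits CARD('r) (alternating_extension (matching_chirotope \<T> A))"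
proof -
  let ?d = "CARD('r)" and ?chi = "alternating_extension (matching_chirotope \<T> A)"
  obtain D N where D: "D \<in> \<T>" and N: "\<And>i j. i \<in> N j \<Longrightarrow> (i, j) \<in> simplex_graph D"
    and cardN: "\<And>j. card (N j) = (if j \<in> \<tau> then 2 else 1)"
    using cocircuit_tree_exists [OF T de \<tau>] by metis
  have ne: "N j \<noteq> {}" for j using cardN [of j] by (auto split: if_splits)
  define G where "G = {(i, j). i \<in> N j}"
  have GD: "G \<subseteq> simplex_graph D" using N by (auto simp: G_def)
  have pd: "covector_pd_graph \<T> G"
    using D GD ne unfolding covector_pd_graph_def G_def by auto
  have forest: "card J < card (\<Union>(N ` J))" if J: "J \<subseteq> \<tau>" "J \<noteq> {}" for J
  proof -
    have "(\<Sum>j\<in>J. card (N j)) = (\<Sum>j\<in>J. 2)" by (rule sum.cong) (use J cardN in auto)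
    moreover have "(\<Sum>j\<in>J. card (N j)) < card J + card (\<Union>(N ` J))"
      by (intro card_columns_less [OF T D] N ne J(2))
    ultimately show ?thesis by simp
  qed
  have two: "card (N j) = 2" if "j \<in> \<tau>" for j using cardN that by simp
  have "\<exists>S. (\<forall>i. S i \<in> {-1, 1}) \<and> (\<forall>j\<in>\<tau>. (\<Sum>i\<in>N j. A i j * S i) = 0)"
    by (intro forest_signing finite two forest A)
  then obtain S where S: "\<And>i. S i \<in> {-1, 1}" "\<And>j. j \<in> \<tau> \<Longrightarrow> (\<Sum>i\<in>N j. A i j * S i) = 0"
    by auto
  \<comment> \<open>A column has two cancelling entries or a single one, so here \<open>psi\<close>
    is the ordinary column sum; the determinant argument rests on this linearity.\<close>
  have psi_both: "psi A S G j = (\<Sum>i\<in>N j. A i j * S i) \<and> (psi A S G j = 0 \<longleftrightarrow> j \<in> \<tau>)" for j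
  proof (cases "j \<in> \<tau>")
    case True
    obtain i i' where i: "N j = {i, i'}" "i \<noteq> i'" using two [OF True] unfolding card_2_iff by metis
    have "A i j * S i + A i' j * S i' = 0" using S(2) [OF True] i by simp
    then have "S i * A i j > 0 \<and> S i' * A i' j < 0 \<or> S i * A i j < 0 \<and> S i' * A i' j > 0"
      using S(1) [of i] S(1) [of i'] A [of i j] A [of i' j] by auto
    moreover have "signed_restriction A S G i j = S i * A i j"
      "signed_restriction A S G i' j = S i' * A i' j"
      by (simp_all add: signed_restriction_def G_def i(1))
    ultimately have "(\<exists>i. signed_restriction A S G i j > 0) \<and> (\<exists>i. signed_restriction A S G i j < 0)"
      by metis
    then have "psi A S G j = 0" by (simp add: psi_def)
    then show ?thesis using S(2) [OF True] True by simp
  next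
    case False
    then have "card (N j) = 1" using cardN by simp
    then obtain i where i: "N j = {i}" by (auto simp: card_1_singleton_iff)
    have c: "signed_restriction A S G i' j = (if i' = i then S i * A i j else 0)" for i'
      by (simp add: signed_restriction_def G_def i)
    have "S i * A i j = 1 \<or> S i * A i j = -1" using S(1) [of i] A [of i j] by auto
    then have "psi A S G j = S i * A i j"
      by (auto simp: psi_def c)
    then show ?thesis using S(1) [of i] A [of i j] False by (auto simp: i)
  qed
  have psi_sum: "psi A S G j = (\<Sum>i\<in>N j. A i j * S i)" and psi_zero: "psi A S G j = 0 \<longleftrightarrow> j \<in> \<tau>" for j
    using psi_both [of j] by blast+
  obtain xs where xs: "set xs = \<tau>" "distinct xs" using finite_distinct_list [of \<tau>] by auto
  have len: "Suc (length xs) = ?d" using xs \<tau> by (simp add: distinct_card [symmetric])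
  define rs where "rs = sorted_list_of_set (UNIV :: 'r set)"
  have rs: "distinct rs" "set rs = UNIV" "length rs = ?d"
    using sorted_list_of_set.length_sorted_key_list_of_set [of "UNIV :: 'r set"] by (simp_all add: rs_def)
  have bij_rs: "bij_betw ((!) rs) {..<?d} UNIV"
    using bij_betw_nth [OF rs(1), of "{..<?d}" UNIV] rs by simp
  define B where "B e = mat ?d ?d (\<lambda>(k, l). if (rs ! k, (e # xs) ! l) \<in> G then A (rs ! k) ((e # xs) ! l) else 0)" for e
  \<comment> \<open>The minor of \<open>B e\<close> without its first row and column. The deleted
    column is the only one depending on \<open>e\<close>, so \<open>c\<close> is common to all
    \<open>e\<close>.\<close>
  define c where "c = det (mat (?d - 1) (?d - 1)
    (\<lambda>(k, l). if (rs ! Suc k, xs ! l) \<in> G then A (rs ! Suc k) (xs ! l) else 0))"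
  have d0: "0 < ?d" by simp
  have chi: "?chi (e # xs) = det (B e) \<and> ?chi (e # xs) \<in> {-1, 1}" if e: "e \<notin> \<tau>" for e
  proof -
    have "card (N e) = 1" using cardN e by simp
    then obtain r where r: "N e = {r}" by (auto simp: card_1_singleton_iff)
    \<comment> \<open>Rooting the forest at the only row \<open>r\<close> of column \<open>e\<close>
      matches \<open>\<tau>\<close> to other rows and reserves \<open>r\<close> for
      \<open>e\<close>; by counting, all rows are used.\<close>
    obtain m where m: "inj_on m \<tau>" "\<And>j. j \<in> \<tau> \<Longrightarrow> m j \<in> N j - {r}"
    proof -
      have "\<exists>m. inj_on m \<tau> \<and> (\<forall>j\<in>\<tau>. m j \<in> N j - {r})"
        by (intro forest_matching finite two forest)
      then show thesis using that by auto
    qed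
    define m' where "m' = m(e := r)"
    have m'N: "m' j \<in> N j" if "j \<in> insert e \<tau>" for j
      using that m(2) [of j] by (auto simp: m'_def r)
    have inj: "inj_on m' (insert e \<tau>)"
    proof (rule inj_on_insert [THEN iffD2, OF conjI])
      have eq: "m' j = m j" if "j \<in> \<tau>" for j using that e by (auto simp: m'_def)
      show "inj_on m' \<tau>" using m(1) inj_on_cong [of \<tau> m' m] eq by simp
      have "m' j \<noteq> m' e" if "j \<in> \<tau>" for j using m(2) [OF that] eq [OF that] by (simp add: m'_def)
      then show "m' e \<notin> m' ` (\<tau> - {e})" by fastforce
    qed
    have "card (m' ` insert e \<tau>) = ?d" using card_image [OF inj] e \<tau> by simp
    then have "m' ` insert e \<tau> = UNIV" by (intro card_subset_eq) simp_all
    then have bij: "bij_betw m' (insert e \<tau>) UNIV" using inj by (simp add: bij_betw_def)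
    define g where "g = inv_into (insert e \<tau>) m'"
    have g: "bij_betw g UNIV (insert e \<tau>)" unfolding g_def by (rule bij_betw_inv_into [OF bij])
    let ?M = "range (\<lambda>i. (i, g i))"
    have set: "set (e # xs) = insert e \<tau>" by (simp add: xs(1))
    have pm: "perfect_matching ?M (set (e # xs))" unfolding set by (rule perfect_matching_graph [OF g])
    have "i \<in> N (g i)" for i
      using m'N [of "g i"] bij_betwE [OF g] bij_betw_inv_into_right [OF bij, of i] by (simp add: g_def)
    then have MG: "?M \<subseteq> G" by (auto simp: G_def)
    have dist: "distinct (e # xs)" "length (e # xs) = ?d" using xs e len by simp_all
    have field: "matching_field \<T> (set (e # xs)) = ?M"
      by (rule matching_field_eq [OF T D pm order_trans [OF MG GD]])
    have "?chi (e # xs) = det (B e)"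
      unfolding B_def
    proof (rule alternating_extension_eq_det [OF dist pm MG field _ rs_def])
      show "M' = ?M" if "perfect_matching M' (set (e # xs))" "M' \<subseteq> G" for M'
        by (rule perfect_matching_unique [OF T D D that(1) order_trans [OF that(2) GD] pm order_trans [OF MG GD]])
    qed
    moreover have "?chi (e # xs) \<in> {-1, 1}"
    proof -
      have absA: "\<bar>A i j\<bar> = 1" for i j using A [of i j] by auto
      have "\<bar>\<Prod>(i, j)\<in>?M. A i j\<bar> = (\<Prod>p\<in>?M. \<bar>case p of (i, j) \<Rightarrow> A i j\<bar>)" by (rule abs_prod)
      also have "\<dots> = 1" by (intro prod.neutral ballI) (simp add: absA case_prod_unfold)
      finally have "\<bar>?chi (e # xs)\<bar> = 1"
        using dist by (simp add: alternating_extension_def matching_chirotope_def field [simplified]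
            matching_sign_def abs_mult sign_def)
      then show ?thesis by auto
    qed
    ultimately show ?thesis by simp
  qed
  \<comment> \<open>Weight the cofactor identity for row 0 by \<open>S\<close>: the columns turn
    into values of \<open>psi\<close>, which vanish on \<open>\<tau>\<close>, so only column 0
    contributes.\<close>
  have key: "S (rs ! 0) * det (B e) = psi A S G e * c" if e: "e \<notin> \<tau>" for e
  proof -
    have B: "B e \<in> carrier_mat ?d ?d" by (simp add: B_def)
    have col: "(\<Sum>k<?d. S (rs ! k) * B e $$ (k, l)) = psi A S G ((e # xs) ! l)" if l: "l < ?d" for l
    proof -
      let ?j = "(e # xs) ! l"
      have "(\<Sum>k<?d. S (rs ! k) * B e $$ (k, l))
          = (\<Sum>k<?d. S (rs ! k) * (if (rs ! k, ?j) \<in> G then A (rs ! k) ?j else 0))"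
        by (rule sum.cong) (use l in \<open>simp_all add: B_def\<close>)
      also have "\<dots> = (\<Sum>i\<in>UNIV. S i * (if (i, ?j) \<in> G then A i ?j else 0))"
        by (rule sum.reindex_bij_betw [OF bij_rs])
      also have "\<dots> = (\<Sum>i\<in>N ?j. A i ?j * S i)"
        by (rule sum.mono_neutral_cong_right) (auto simp: G_def)
      finally show ?thesis by (simp add: psi_sum)
    qed
    have "S (rs ! 0) * det (B e) = (\<Sum>k<?d. S (rs ! k) * (if k = 0 then det (B e) else 0))"
      using d0 by (simp add: if_distrib [of "\<lambda>x. _ * x"] cong: if_cong)
    also have "\<dots> = (\<Sum>k<?d. S (rs ! k) * (\<Sum>l<?d. B e $$ (k, l) * cofactor (B e) 0 l))"
      by (rule sum.cong) (simp_all add: sum_mult_cofactor [OF B])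
    also have "\<dots> = (\<Sum>l<?d. (\<Sum>k<?d. S (rs ! k) * B e $$ (k, l)) * cofactor (B e) 0 l)"
      unfolding sum_distrib_left sum_distrib_right by (subst sum.swap) (simp add: mult.assoc)
    also have "\<dots> = (\<Sum>l<?d. psi A S G ((e # xs) ! l) * cofactor (B e) 0 l)"
      by (rule sum.cong) (simp_all add: col)
    also have "\<dots> = (\<Sum>l\<in>{0}. psi A S G ((e # xs) ! l) * cofactor (B e) 0 l)"
    proof (rule sum.mono_neutral_right)
      show "\<forall>l\<in>{..<?d} - {0}. psi A S G ((e # xs) ! l) * cofactor (B e) 0 l = 0"
      proof
        fix l assume l: "l \<in> {..<?d} - {0}"
        then obtain l' where l': "l = Suc l'" by (cases l) auto
        then have "(e # xs) ! l \<in> \<tau>" using l len nth_mem [of l' xs] xs(1) by simp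
        then show "psi A S G ((e # xs) ! l) * cofactor (B e) 0 l = 0" by (simp add: psi_zero)
      qed
    qed (use d0 in auto)
    also have "\<dots> = psi A S G e * cofactor (B e) 0 0" by simp
    also have "cofactor (B e) 0 0 = c"
    proof -
      have "mat_delete (B e) 0 0 = mat (?d - 1) (?d - 1)
          (\<lambda>(k, l). if (rs ! Suc k, xs ! l) \<in> G then A (rs ! Suc k) (xs ! l) else 0)"
        by (rule eq_matI) (simp_all add: mat_delete_def B_def)
      then show ?thesis by (simp add: cofactor_def c_def)
    qed
    finally show ?thesis .
  qed
  have "card \<tau> < card (UNIV :: 'e set)" using de \<tau> by linarith
  then have "\<tau> \<noteq> UNIV" by auto
  then obtain e0 where e0: "e0 \<notin> \<tau>" by auto
  have S0: "S (rs ! 0) \<in> {-1, 1}" by (rule S(1))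
  have psi_pm: "psi A S G e \<in> {-1, 1}" if "e \<notin> \<tau>" for e
    using psi_values [of A S G e] psi_zero [of e] that by auto
  \<comment> \<open>An \<open>e0\<close> outside \<open>\<tau>\<close> exists since
    \<open>d \<le> n\<close>, and there the other three factors in \<open>key\<close> are
    signs.\<close>
  have c: "c \<in> {-1, 1}"
    using key [OF e0] chi [OF e0] S0 psi_pm [OF e0] by auto
  \<comment> \<open>For \<open>e\<close> in \<open>\<tau>\<close> the list \<open>e # xs\<close>
    repeats an entry and \<open>?chi\<close> is 0 by definition; elsewhere \<open>key\<close> is
    solved using \<open>c * c = 1\<close>.\<close>
  have eq: "psi A S G e = (S (rs ! 0) * c) * ?chi (e # xs)" for e
  proof (cases "e \<in> \<tau>")
    case True
    then have "?chi (e # xs) = 0" by (simp add: alternating_extension_def xs(1))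
    then show ?thesis using psi_zero [of e] True by simp
  next
    case False
    have "c * c = 1" using c by auto
    then have "psi A S G e = (psi A S G e * c) * c" by (simp add: mult.assoc)
    also have "\<dots> = S (rs ! 0) * det (B e) * c" by (simp only: key [OF False])
    finally show ?thesis using chi [OF False] by (simp add: ac_simps)
  qed
  have "S (rs ! 0) * c = 1 \<or> S (rs ! 0) * c = -1" using S0 c by auto
  then have "psi A S G = (\<lambda>e. ?chi (e # xs)) \<or> psi A S G = (\<lambda>e. - ?chi (e # xs))"
    using eq by (auto simp: fun_eq_iff)
  moreover have "length xs = ?d - 1" using len by simp
  moreover have "psi A S G \<noteq> (\<lambda>e. 0)" using psi_zero [of e0] e0 by (auto simp: fun_eq_iff)
  ultimately have "psi A S G \<in> signed_cocircuits ?d ?chi"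
    unfolding signed_cocircuits_def by auto
  then show ?thesis using pd S(1) psi_zero by (intro exI [of _ S] exI [of _ G] conjI allI) auto
qed

lemma signed_cocircuits_uminus:
  assumes "Y \<in> signed_cocircuits d chi"
  shows "(\<lambda>j. - Y j) \<in> signed_cocircuits d chi"
proof -
  obtain xs where xs: "length xs = d - 1" "Y = (\<lambda>e. chi (e # xs)) \<or> Y = (\<lambda>e. - chi (e # xs))"
    and "Y \<noteq> (\<lambda>e. 0)"
    using assms unfolding signed_cocircuits_def by auto
  moreover then have "(\<lambda>j. - Y j) \<noteq> (\<lambda>e. 0)" by (auto simp: fun_eq_iff)
  ultimately show ?thesis unfolding signed_cocircuits_def by (intro CollectI conjI exI [of _ xs]) auto
qed

lemma matched_circuits_uminus:
  assumes "X \<in> matched_circuits \<T> A"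
  shows "(\<lambda>j. - X j) \<in> matched_circuits \<T> A"
proof -
  obtain D where X: "\<And>j. X j \<in> {-1, 0, 1}" and D: "D \<in> \<T>"
    and K: "\<And>i t. t \<in> {-1, 1} \<Longrightarrow> \<exists>j. (i, j) \<in> simplex_graph D \<and> A i j * X j = t"
    using assms unfolding matched_circuits_def by auto
  have "\<exists>j. (i, j) \<in> simplex_graph D \<and> A i j * - X j = t" if "t \<in> {-1, 1}" for i t
    using K [of "- t" i] that by auto
  moreover have "- X j \<in> {-1, 0, 1}" for j using X [of j] by auto
  ultimately show ?thesis
    unfolding matched_circuits_def by (intro CollectI conjI allI bexI [OF _ D] ballI)
qed

section \<open>Conformal decomposition\<close>

text \<open>A Farkas alternative. \<open>Q\<close> carries the sign constraints. On \<open>C\<close>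
  cocircuits vanish and circuits are free (contraction); outside \<open>C \<union> Q\<close>
  circuits vanish and cocircuits are non-zero of either sign (deletion). The induction takes one
  element out of \<open>Q\<close> in both ways.\<close>

lemma conformal_cocircuit_or_circuit:
  fixes CC DD :: "('e::finite \<Rightarrow> int) set" and Z :: "'e \<Rightarrow> int"
  assumes X: "\<And>\<rho>. card \<rho> = Suc d \<Longrightarrow> \<exists>X\<in>CC. \<forall>j. X j \<noteq> 0 \<longleftrightarrow> j \<in> \<rho>"
    and X_uminus: "\<And>X. X \<in> CC \<Longrightarrow> (\<lambda>j. - X j) \<in> CC"
    and X_sign: "\<And>X j. X \<in> CC \<Longrightarrow> X j \<in> {-1, 0, 1}"
    and Y: "\<And>\<tau>. Suc (card \<tau>) = d \<Longrightarrow> \<exists>Y\<in>DD. \<forall>j. Y j = 0 \<longleftrightarrow> j \<in> \<tau>"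
    and Y_uminus: "\<And>Y. Y \<in> DD \<Longrightarrow> (\<lambda>j. - Y j) \<in> DD"
    and Y_sign: "\<And>Y j. Y \<in> DD \<Longrightarrow> Y j \<in> {-1, 0, 1}"
    and orth: "\<And>X Y. X \<in> CC \<Longrightarrow> Y \<in> DD \<Longrightarrow> \<exists>j. X j * Y j < 0"
    and "C \<inter> Q = {}" "card C \<le> d" "d \<le> card C + card Q" "e \<in> Q"
    and "\<And>f. f \<in> Q \<Longrightarrow> Z f \<in> {-1, 1}"
  shows "(\<exists>Y\<in>DD. (\<forall>j. Y j = 0 \<longrightarrow> j \<in> C \<union> Q) \<and> (\<forall>f\<in>C. Y f = 0) \<and> (\<forall>f\<in>Q. Y f \<in> {0, Z f}) \<and> Y e = Z e) \<or>
    (\<exists>X\<in>CC. (\<forall>j. X j \<noteq> 0 \<longrightarrow> j \<in> C \<union> Q) \<and> (\<forall>f\<in>Q. X f \<in> {0, Z f}) \<and> X e = Z e)"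
proof -
  define co where "co C Q Y \<longleftrightarrow> (\<forall>j. Y j = 0 \<longrightarrow> j \<in> C \<union> Q) \<and> (\<forall>f\<in>C. Y f = 0) \<and>
    (\<forall>f\<in>Q. Y f \<in> {0, Z f}) \<and> Y e = Z e" for C Q Y
  define ci where "ci C Q X \<longleftrightarrow> (\<forall>j. X j \<noteq> 0 \<longrightarrow> j \<in> C \<union> Q) \<and>
    (\<forall>f\<in>Q. X f \<in> {0, Z f}) \<and> X e = Z e" for C Q X
  have "(\<exists>Y\<in>DD. co C Q Y) \<or> (\<exists>X\<in>CC. ci C Q X)"
    using assms(8-)
  proof (induction "card Q" arbitrary: C Q)
    case 0
    then show ?case by simp
  next
    case (Suc q Q C)
    have Ze: "Z e \<in> {-1, 1}" by (rule Suc.prems(5) [OF Suc.prems(4)])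
    \<comment> \<open>Terminal cases: for \<open>rank0\<close> the circuit on
      \<open>insert e C\<close> works up to sign, for \<open>free\<close> the cocircuit vanishing on
      \<open>C \<union> Q - {e}\<close>. In between, deletion and contraction both keep the size
      bounds.\<close>
    consider (rank0) "card C = d" | (free) "card C + card Q = d"
      | (step) "card C < d" "d < card C + card Q" using Suc.prems by linarith
    then show ?case
    proof cases
      case rank0
      have "e \<notin> C" using Suc.prems(1,4) by blast
      then have "card (insert e C) = Suc d" using rank0 by simp
      then obtain X where X': "X \<in> CC" "\<forall>j. X j \<noteq> 0 \<longleftrightarrow> j \<in> insert e C" using X by blast
      then have Xe: "X e \<in> {-1, 1}" using X_sign [OF X'(1), of e] by auto
      have off: "X f = 0" if "f \<in> Q" "f \<noteq> e" for f using X'(2) that Suc.prems(1) by auto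
      have sub: "\<forall>j. X j \<noteq> 0 \<longrightarrow> j \<in> C \<union> Q" using X'(2) Suc.prems(4) by auto
      show ?thesis
      proof (cases "X e = Z e")
        case True
        then show ?thesis using X'(1) off sub by (intro disjI2 bexI [of _ X]) (auto simp: ci_def)
      next
        case False
        then have "- X e = Z e" using Xe Ze by auto
        then show ?thesis using X_uminus [OF X'(1)] off sub
          by (intro disjI2 bexI [of _ "\<lambda>j. - X j"]) (auto simp: ci_def)
      qed
    next
      case free
      have "card (C \<union> Q) = d" using free Suc.prems(1) by (simp add: card_Un_disjoint)
      moreover have "card (C \<union> Q) = Suc (card (C \<union> Q - {e}))"
        by (rule card.remove) (use Suc.prems(4) in auto)
      ultimately have "Suc (card (C \<union> Q - {e})) = d" by simp
      then obtain Y where Y': "Y \<in> DD" "\<forall>j. Y j = 0 \<longleftrightarrow> j \<in> C \<union> Q - {e}" using Y by blast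
      then have Ye: "Y e \<in> {-1, 1}" using Y_sign [OF Y'(1), of e] by auto
      have off: "Y f = 0" if "f \<in> C \<union> Q" "f \<noteq> e" for f using Y'(2) that by auto
      have eC: "e \<notin> C" using Suc.prems(1,4) by blast
      show ?thesis
      proof (cases "Y e = Z e")
        case True
        then show ?thesis using Y' off eC by (intro disjI1 bexI [of _ Y]) (auto simp: co_def)
      next
        case False
        then have "- Y e = Z e" using Ye Ze by auto
        then show ?thesis using Y_uminus [OF Y'(1)] Y'(2) off eC
          by (intro disjI1 bexI [of _ "\<lambda>j. - Y j"]) (auto simp: co_def)
      qed
    next
      case step
      have "2 \<le> card Q" using step by linarith
      then have "Q \<noteq> {e}" by auto
      then obtain f where f: "f \<in> Q" "f \<noteq> e" using Suc.prems(4) by blast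
      have q: "q = card (Q - {f})" using Suc.hyps(2) f(1) by (simp add: card_Diff_singleton)
      have fC: "f \<notin> C" using f Suc.prems(1) by blast
      have Zf: "Z f \<in> {-1, 1}" by (rule Suc.prems(5) [OF f(1)])
      have del: "(\<exists>Y\<in>DD. co C (Q - {f}) Y) \<or> (\<exists>X\<in>CC. ci C (Q - {f}) X)"
        by (rule Suc.hyps(1) [OF q]) (use Suc.prems f step q Suc.hyps(2) in auto)
      have con: "(\<exists>Y\<in>DD. co (insert f C) (Q - {f}) Y) \<or> (\<exists>X\<in>CC. ci (insert f C) (Q - {f}) X)"
        by (rule Suc.hyps(1) [OF q]) (use Suc.prems f fC step q Suc.hyps(2) in auto)
      show ?thesis
      proof (rule ccontr)
        assume "\<not> ?thesis"
        then have no: "Y \<in> DD \<Longrightarrow> \<not> co C Q Y" "X \<in> CC \<Longrightarrow> \<not> ci C Q X" for X Y by blast+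
        \<comment> \<open>A circuit from the deletion and a cocircuit from the contraction both
          vanish at \<open>f\<close>, so either would solve the original problem. What remains is a
          cocircuit \<open>Y\<close> from the deletion and a circuit \<open>X\<close> from the
          contraction.\<close>
        have "ci C Q X" if X: "ci C (Q - {f}) X" for X
          unfolding ci_def
        proof (intro conjI allI impI ballI)
          have Xf: "X f = 0" using X fC unfolding ci_def by auto
          fix g show "X g \<in> {0, Z g}" if "g \<in> Q"
            using X that Xf unfolding ci_def by (cases "g = f") auto
        qed (use X in \<open>auto simp: ci_def\<close>)
        then obtain Y where Y': "Y \<in> DD" "co C (Q - {f}) Y" using del no(2) by blast
        have "co C Q Y" if Y: "co (insert f C) (Q - {f}) Y" for Y
          unfolding co_def
        proof (intro conjI allI impI ballI)
          fix g show "Y g \<in> {0, Z g}" if "g \<in> Q"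
            using Y that unfolding co_def by (cases "g = f") auto
        qed (use Y f(1) in \<open>auto simp: co_def\<close>)
        then obtain X where X': "X \<in> CC" "ci (insert f C) (Q - {f}) X" using con no(1) by blast
        have Y1: "\<And>j. Y j = 0 \<Longrightarrow> j \<in> C \<union> (Q - {f})" "\<And>g. g \<in> C \<Longrightarrow> Y g = 0"
          "\<And>g. g \<in> Q - {f} \<Longrightarrow> Y g \<in> {0, Z g}" "Y e = Z e"
          using Y'(2) unfolding co_def by auto
        have X1: "\<And>j. X j \<noteq> 0 \<Longrightarrow> j \<in> C \<union> Q"
          "\<And>g. g \<in> Q - {f} \<Longrightarrow> X g \<in> {0, Z g}" "X e = Z e"
          using X'(2) f(1) unfolding ci_def by auto
        have Yf0: "Y f \<noteq> 0" using Y1(1) [of f] fC by auto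
        have Yf1: "Y f \<noteq> Z f"
        proof
          assume "Y f = Z f"
          then have "Y g \<in> {0, Z g}" if "g \<in> Q" for g
            using Y1(3) [of g] that by (cases "g = f") auto
          then have "co C Q Y" unfolding co_def using Y1 by auto
          then show False using no(1) Y'(1) by blast
        qed
        have Yf: "Y f = - Z f" using Y_sign [OF Y'(1), of f] Zf Yf0 Yf1 by auto
        have "X f \<notin> {0, Z f}"
        proof
          assume "X f \<in> {0, Z f}"
          then have "X g \<in> {0, Z g}" if "g \<in> Q" for g
            using X1(2) [of g] that by (cases "g = f") auto
          then have "ci C Q X" unfolding ci_def using X1 by auto
          then show False using no(2) X'(1) by blast
        qed
        then have Xf: "X f = - Z f" using X_sign [OF X'(1), of f] Zf by auto
        \<comment> \<open>\<open>X\<close> and \<open>Y\<close> agree at \<open>f\<close>, both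
          being \<open>- Z f\<close>; on the rest of \<open>Q\<close> both follow \<open>Z\<close>,
          and elsewhere one of them is 0. So no product is negative, against orthogonality.\<close>
        obtain g where g: "X g * Y g < 0" using orth [OF X'(1) Y'(1)] by blast
        then have ne: "X g \<noteq> 0" "Y g \<noteq> 0" by auto
        then have "g \<in> Q" using X1(1) [of g] Y1(2) [of g] by auto
        moreover have "g \<noteq> f" using g Xf Yf Zf by auto
        ultimately have "X g = Z g" "Y g = Z g" using X1(2) [of g] Y1(3) [of g] ne by auto
        then show False using g by (simp add: mult_less_0_iff)
      qed
    qed
  qed
  then show ?thesis unfolding co_def ci_def .
qed

text \<open>All vectors involved take only the values 0 and \<open>Z f\<close>, so composing with a
  further cocircuit never spoils an entry that already agrees with \<open>Z\<close>.\<close>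

lemma covector_of_conformal_cocircuits:
  fixes Z :: "'e::finite \<Rightarrow> int"
  assumes "\<And>e. Z e \<noteq> 0 \<Longrightarrow> \<exists>Y\<in>signed_cocircuits d chi. (\<forall>f. Y f \<in> {0, Z f}) \<and> Y e = Z e"
  shows "Z \<in> covectors d chi"
proof -
  have "\<exists>X\<in>covectors d chi. (\<forall>f. X f \<in> {0, Z f}) \<and> (\<forall>f\<in>P. X f = Z f)" if "finite P" for P
    using that
  proof induction
    case empty
    show ?case using covectors.zero by (rule bexI [rotated]) simp
  next
    case (insert e P)
    then obtain X where X: "X \<in> covectors d chi" "\<forall>f. X f \<in> {0, Z f}" "\<forall>f\<in>P. X f = Z f" by blast
    show ?case
    proof (cases "Z e = 0")
      case True
      then show ?thesis using X by (intro bexI [OF _ X(1)]) auto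
    next
      case False
      then obtain Y where Y: "Y \<in> signed_cocircuits d chi" "\<forall>f. Y f \<in> {0, Z f}" "Y e = Z e"
        using assms by blast
      show ?thesis
        by (rule bexI [OF _ covectors.comp [OF Y(1) X(1)]])
          (use X(2,3) Y(2,3) False in \<open>auto simp: sign_comp_def\<close>)
    qed
  qed
  from this [of UNIV] obtain X where "X \<in> covectors d chi" "\<forall>f. X f = Z f" by auto
  then show ?thesis by (metis ext)
qed

section \<open>From orthogonality to covectors\<close>

theorem corollary3p33:
  fixes \<T> :: "((real ^ 'r::{finite,linorder}) \<times> (real ^ 'e::{finite,linorder})) set set"
    and A :: "'r \<Rightarrow> 'e \<Rightarrow> int"
    and F :: "('r \<times> 'e) set"
    and S :: "'r \<Rightarrow> int"
  assumes "CARD('r) \<le> CARD('e)"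
    and "product_triangulation \<T>"
    and "\<forall>i j. A i j \<in> {-1, 1}"
    and "covector_pd_graph \<T> F"
    and "\<forall>i. S i \<in> {-1, 0, 1}"
    and "{i. \<exists>j. (i, j) \<in> F} \<subseteq> {i. S i \<noteq> 0}"
  shows "psi A S F \<in>
    covectors CARD('r) (alternating_extension (matching_chirotope \<T> A))"
proof (rule covector_of_conformal_cocircuits)
  let ?d = "CARD('r)" and ?chi = "alternating_extension (matching_chirotope \<T> A)"
  let ?Z = "psi A S F" and ?CC = "matched_circuits \<T> A"
  note T = assms(2)
  have A: "A i j \<in> {-1, 1}" for i j using assms(3) by simp
  have orthZ: "\<exists>j. X j * ?Z j < 0" if "X \<in> ?CC" for X
    by (rule psi_orthogonal_circuit [where A = A, OF T A assms(4) _ _ that]) (use assms(5,6) in auto)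
  \<comment> \<open>Orthogonality is built into \<open>DD\<close>. The tree cocircuits belong to it
    because they have the form \<open>psi A S' G\<close>, to which
    \<open>psi_orthogonal_circuit\<close> applies.\<close>
  define DD where "DD = {Y \<in> signed_cocircuits ?d ?chi. (\<forall>j. Y j \<in> {-1, 0, 1}) \<and>
    (\<forall>X\<in>?CC. \<exists>j. X j * Y j < 0)}"
  have X: "\<exists>X\<in>?CC. \<forall>j. X j \<noteq> 0 \<longleftrightarrow> j \<in> \<rho>" if "card \<rho> = Suc ?d" for \<rho>
    by (rule matched_circuit_exists [where A = A, OF T A that])
  have Xv: "X j \<in> {-1, 0, 1}" if "X \<in> ?CC" for X j
    using that unfolding matched_circuits_def by simp
  have Y: "\<exists>Y\<in>DD. \<forall>j. Y j = 0 \<longleftrightarrow> j \<in> \<tau>" if \<tau>: "Suc (card \<tau>) = ?d" for \<tau>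
  proof -
    obtain S' G where G: "covector_pd_graph \<T> G" "\<forall>i. S' i \<in> {-1, 1}"
      "\<forall>j. psi A S' G j = 0 \<longleftrightarrow> j \<in> \<tau>" "psi A S' G \<in> signed_cocircuits ?d ?chi"
      using tree_cocircuit_exists [where A = A, OF T A assms(1) \<tau>] by (elim exE conjE)
    have S': "S' i \<in> {-1, 0, 1}" "S' i \<noteq> 0" for i using G(2) [rule_format, of i] by auto
    have "\<exists>j. X j * psi A S' G j < 0" if "X \<in> ?CC" for X
      by (rule psi_orthogonal_circuit [where A = A, OF T A G(1) S' that])
    then have "psi A S' G \<in> DD" unfolding DD_def using G(4) psi_values [of A S' G] by auto
    then show ?thesis by (intro bexI [of _ "psi A S' G"] G(3))
  qed
  have Yneg: "(\<lambda>j. - Y j) \<in> DD" if "Y \<in> DD" for Y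
  proof -
    have Y: "Y \<in> signed_cocircuits ?d ?chi" "\<And>j. Y j \<in> {-1, 0, 1}"
      "\<And>X. X \<in> ?CC \<Longrightarrow> \<exists>j. X j * Y j < 0" using that unfolding DD_def by auto
    have "\<exists>j. X j * - Y j < 0" if "X \<in> ?CC" for X
      using Y(3) [OF matched_circuits_uminus [OF that]] by simp
    moreover have "- Y j \<in> {-1, 0, 1}" for j using Y(2) [of j] by auto
    ultimately show ?thesis
      unfolding DD_def using signed_cocircuits_uminus [OF Y(1)] by (intro CollectI conjI allI ballI)
  qed
  have Yv: "Y j \<in> {-1, 0, 1}" if "Y \<in> DD" for Y j using that unfolding DD_def by simp
  have orth: "\<exists>j. X j * Y j < 0" if "X \<in> ?CC" "Y \<in> DD" for X Y
    using that unfolding DD_def by simp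
  \<comment> \<open>Contracting the zeros of \<open>?Z\<close> and constraining its whole support
    leaves nothing outside \<open>C \<union> Q\<close>, so a cocircuit obtained conforms to
    \<open>?Z\<close> everywhere.\<close>
  define C where "C = {j. ?Z j = 0}"
  define Q where "Q = {j. ?Z j \<noteq> 0}"
  have CQ: "C \<inter> Q = {}" "C \<union> Q = UNIV" by (auto simp: C_def Q_def)
  \<comment> \<open>A circuit supported on \<open>d + 1\<close> zeros of \<open>?Z\<close> would
    have only zero products with it.\<close>
  have cardC: "card C \<le> ?d"
  proof (rule ccontr)
    assume "\<not> card C \<le> ?d"
    then obtain \<rho> where \<rho>: "\<rho> \<subseteq> C" "card \<rho> = Suc ?d"
      using obtain_subset_with_card_n [of "Suc ?d" C] by (metis Suc_leI not_less)
    obtain X where X': "X \<in> ?CC" "\<forall>j. X j \<noteq> 0 \<longleftrightarrow> j \<in> \<rho>" using X [OF \<rho>(2)] by (rule bexE)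
    obtain j where j: "X j * ?Z j < 0" using orthZ [OF X'(1)] by (rule exE)
    then have "X j \<noteq> 0" by auto
    then have "j \<in> C" using X'(2) \<rho>(1) by auto
    then show False using j by (simp add: C_def)
  qed
  have dle: "?d \<le> card C + card Q"
    using card_Un_disjoint [of C Q] CQ assms(1) by simp
  have Zv: "?Z f \<in> {-1, 1}" if "f \<in> Q" for f
    using psi_values [of A S F f] that by (auto simp: Q_def)
  have alt: "(\<exists>Y\<in>DD. (\<forall>j. Y j = 0 \<longrightarrow> j \<in> C \<union> Q) \<and> (\<forall>f\<in>C. Y f = 0) \<and>
      (\<forall>f\<in>Q. Y f \<in> {0, ?Z f}) \<and> Y e = ?Z e) \<or>
    (\<exists>X\<in>?CC. (\<forall>j. X j \<noteq> 0 \<longrightarrow> j \<in> C \<union> Q) \<and> (\<forall>f\<in>Q. X f \<in> {0, ?Z f}) \<and> X e = ?Z e)"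
    if "e \<in> Q" for e
    by (rule conformal_cocircuit_or_circuit [of ?d ?CC DD C Q e ?Z])
      (fact X matched_circuits_uminus Xv Y Yneg Yv orth CQ(1) cardC dle that Zv)+
  fix e assume "?Z e \<noteq> 0"
  then have e: "e \<in> Q" by (simp add: Q_def)
  \<comment> \<open>A conforming circuit has no negative product with \<open>?Z\<close>, against
    \<open>orthZ\<close>; this leaves the cocircuit alternative.\<close>
  have "\<not> (\<exists>X\<in>?CC. (\<forall>j. X j \<noteq> 0 \<longrightarrow> j \<in> C \<union> Q) \<and> (\<forall>f\<in>Q. X f \<in> {0, ?Z f}) \<and> X e = ?Z e)"
  proof
    assume "\<exists>X\<in>?CC. (\<forall>j. X j \<noteq> 0 \<longrightarrow> j \<in> C \<union> Q) \<and> (\<forall>f\<in>Q. X f \<in> {0, ?Z f}) \<and> X e = ?Z e"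
    then obtain X where X': "X \<in> ?CC" "\<And>f. f \<in> Q \<Longrightarrow> X f \<in> {0, ?Z f}" by auto
    obtain j where j: "X j * ?Z j < 0" using orthZ [OF X'(1)] by (rule exE)
    then have "j \<in> Q" by (auto simp: Q_def)
    from X'(2) [OF this] show False using j by (auto simp: mult_less_0_iff)
  qed
  with alt [OF e] obtain Y where Y': "Y \<in> DD" "\<forall>f\<in>C. Y f = 0" "\<forall>f\<in>Q. Y f \<in> {0, ?Z f}" "Y e = ?Z e"
    by (simp only: simp_thms) (elim bexE conjE)
  have "Y f \<in> {0, ?Z f}" for f
  proof (cases "f \<in> Q")
    case True
    then show ?thesis using Y'(3) by simp
  next
    case False
    then show ?thesis using Y'(2) CQ(2) by auto
  qed
  moreover have "Y \<in> signed_cocircuits ?d ?chi" using Y'(1) unfolding DD_def by simp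
  ultimately show "\<exists>Y\<in>signed_cocircuits ?d ?chi. (\<forall>f. Y f \<in> {0, ?Z f}) \<and> Y e = ?Z e"
    using Y'(4) by (intro bexI [of _ Y] conjI allI)
qed

end
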